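(* Fix $n \geq 1$, and let $\mathcal{M}$ be a countable Scott set such that for every $s \in \{1, \dots, n\}$ there is some $\ell_s \ge 1$ with $\mathcal{M} \models \mathsf{RT}^s_{<\infty, \ell_s}$. Let $$\ell = \ell_n + \sum_{\sigma \in \mathrm{Dec}_n} \vec{\ell}(n,\sigma) \cdot \ell_{\sigma^{+}}.$$ Then for every set $B \notin \mathcal{M}$, every $k\in\omega$ and every coloring $f : [\omega]^n \to k$, there is an infinite set $G$ with $|f[G]^n| \leq \ell$ such that $B \not\leq_T G \oplus C$ for every $C \in \mathcal{M}$.
   Context: A Scott set is a nonempty collection $\mathcal{M}$ of subsets of $\omega$ closed under Turing reducibility and join, such that every infinite binary tree in $\mathcal{M}$ has an infinite path in $\mathcal{M}$. $[X]^s$ is the set of $s$-element subsets of $X$. $\mathcal{M} \models \mathsf{RT}^s_{<\infty,\ell_s}$ means: for every $k$ and every coloring $h : [\omega]^s \to k$ in $\mathcal{M}$ there is an infinite $H \in \mathcal{M}$ with $|h[H]^s| \leq \ell_s$. $\mathrm{Dec}_n$ is the set of all strictly decreasing non-empty finite sequences over $\{1, \dots, n-1\}$; for $\sigma \in \mathrm{Dec}_n$, $\sigma^{+}$ denotes its last (smallest) element. For $\sigma = n_0 n_1 \dots n_s \in \mathrm{Dec}_n$ (so $n_0 > n_1 > \dots > n_s$), $\vec{\ell}(n,\sigma) = \ell_{n-n_0} \cdot \prod_{i=1}^s \ell_{n_{i-1}-n_i}$. *)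

theory Defs
  imports "HOL-Library.Ramsey" "HOL-Library.Sublist" "HOL-Library.Nat_Bijection"
    "HOL-Library.Countable_Set"
begin

section \<open>Turing reducibility\<close>

text \<open>
  Programs for the partial recursive functions relative to an oracle (Kleene's schemes).
  A program takes a list of arguments.
\<close>

datatype prog =
    Zero
  | Succ
  | Proj nat
  | Query
  | Comp prog "prog list"
  | PrimRec prog prog
  | Mu prog

inductive eval :: "nat set \<Rightarrow> prog \<Rightarrow> nat list \<Rightarrow> nat \<Rightarrow> bool" for A :: "nat set" where
  zero: "eval A Zero xs 0"
| succ: "eval A Succ [x] (Suc x)"
| proj: "i < length xs \<Longrightarrow> eval A (Proj i) xs (xs ! i)"
| query: "eval A Query [x] (if x \<in> A then 1 else 0)"
| comp: "list_all2 (\<lambda>g y. eval A g xs y) gs ys \<Longrightarrow> eval A f ys z \<Longrightarrow> eval A (Comp f gs) xs z"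
| primrec_0: "eval A f xs y \<Longrightarrow> eval A (PrimRec f g) (0 # xs) y"
| primrec_Suc: "eval A (PrimRec f g) (m # xs) r \<Longrightarrow> eval A g (m # r # xs) y
    \<Longrightarrow> eval A (PrimRec f g) (Suc m # xs) y"
| mu: "eval A f (m # xs) 0 \<Longrightarrow> (\<And>j. j < m \<Longrightarrow> \<exists>y. eval A f (j # xs) (Suc y))
    \<Longrightarrow> eval A (Mu f) xs m"

inductive_cases eval_ZeroE: "eval A Zero xs z"
inductive_cases eval_SuccE: "eval A Succ xs z"
inductive_cases eval_ProjE: "eval A (Proj i) xs z"
inductive_cases eval_QueryE: "eval A Query xs z"
inductive_cases eval_CompE: "eval A (Comp f gs) xs z"
inductive_cases eval_PrimRec_0E: "eval A (PrimRec f g) (0 # xs) z"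
inductive_cases eval_PrimRec_SucE: "eval A (PrimRec f g) (Suc m # xs) z"
inductive_cases eval_MuE: "eval A (Mu f) xs z"

lemma eval_deterministic: "eval A p xs y \<Longrightarrow> eval A p xs z \<Longrightarrow> y = z"
proof (induction arbitrary: z rule: eval.induct)
  case (zero xs)
  then show ?case by (rule eval_ZeroE) simp
next
  case (succ x)
  then show ?case by (rule eval_SuccE) simp
next
  case (proj i xs)
  from proj.prems show ?case by (rule eval_ProjE) simp
next
  case (query x)
  then show ?case by (rule eval_QueryE) simp
next
  case (comp xs gs ys f z')
  from comp.prems obtain ys' where
    *: "list_all2 (\<lambda>g y. eval A g xs y) gs ys'" "eval A f ys' z"
    by (rule eval_CompE)
  have "ys = ys'"
    using comp.IH(1) *(1) by (auto simp: list_all2_conv_all_nth intro!: nth_equalityI)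
  with * comp.IH(2) show ?case by blast
next
  case (primrec_0 f xs y g)
  from primrec_0.prems show ?case by (rule eval_PrimRec_0E) (rule primrec_0.IH)
next
  case (primrec_Suc f g m xs r y)
  from primrec_Suc.prems obtain r' where
    *: "eval A (PrimRec f g) (m # xs) r'" "eval A g (m # r' # xs) z"
    by (rule eval_PrimRec_SucE)
  then show ?case using primrec_Suc.IH by blast
next
  case (mu f m xs)
  from mu.prems have z: "eval A f (z # xs) 0" and
    below: "\<And>j. j < z \<Longrightarrow> \<exists>y. eval A f (j # xs) (Suc y)"
    by (rule eval_MuE, blast)+
  show ?case
  proof (rule linorder_cases[of m z])
    assume "m < z"
    then obtain y where "eval A f (m # xs) (Suc y)" using below by blast
    then have "0 = Suc y" by (rule mu.IH(1))
    then show ?thesis by simp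
  next
    assume "z < m"
    then obtain y where "\<forall>u. eval A f (z # xs) u \<longrightarrow> Suc y = u" using mu.IH(2) by blast
    then have "Suc y = 0" using z by blast
    then show ?thesis by simp
  qed
qed

definition turing_reducible :: "nat set \<Rightarrow> nat set \<Rightarrow> bool"  (infix \<open>\<le>\<^sub>T\<close> 50) where
  "B \<le>\<^sub>T A \<longleftrightarrow> (\<exists>p. \<forall>x. eval A p [x] (if x \<in> B then 1 else 0))"

definition turing_join :: "nat set \<Rightarrow> nat set \<Rightarrow> nat set"  (infixl \<open>\<oplus>\<^sub>T\<close> 65) where
  "A \<oplus>\<^sub>T B = (\<lambda>x. 2 * x) ` A \<union> (\<lambda>x. 2 * x + 1) ` B"


section \<open>Scott sets\<close>

definition binary_tree :: "bool list set \<Rightarrow> bool" where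
  "binary_tree T \<longleftrightarrow> (\<forall>\<sigma>\<in>T. \<forall>\<tau>. prefix \<tau> \<sigma> \<longrightarrow> \<tau> \<in> T)"

text \<open>A subset of \<open>\<omega>\<close> is identified with its characteristic function when it is viewed as a path.\<close>

definition path_through :: "nat set \<Rightarrow> bool list set \<Rightarrow> bool" where
  "path_through P T \<longleftrightarrow> (\<forall>m. map (\<lambda>i. i \<in> P) [0..<m] \<in> T)"

text \<open>Sets of strings are coded as sets of numbers by coding each string effectively.\<close>

definition tree_code :: "bool list set \<Rightarrow> nat set" where
  "tree_code T = (\<lambda>\<sigma>. list_encode (map of_bool \<sigma>)) ` T"

definition Scott_set :: "nat set set \<Rightarrow> bool" where
  "Scott_set \<M> \<longleftrightarrow>
     \<M> \<noteq> {} \<and>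
     (\<forall>A\<in>\<M>. \<forall>B. B \<le>\<^sub>T A \<longrightarrow> B \<in> \<M>) \<and>
     (\<forall>A\<in>\<M>. \<forall>B\<in>\<M>. A \<oplus>\<^sub>T B \<in> \<M>) \<and>
     (\<forall>T. binary_tree T \<and> infinite T \<and> tree_code T \<in> \<M> \<longrightarrow> (\<exists>P\<in>\<M>. path_through P T))"


section \<open>Ramsey's theorem for finitely many colors, with bounded color sets\<close>

text \<open>
  A coloring of \<open>[\<omega>]\<^sup>s\<close> belongs to a collection of subsets of \<open>\<omega>\<close> if its graph does, where
  \<open>s\<close>-element sets are represented by their canonical indices.
\<close>

definition coloring_code :: "nat \<Rightarrow> (nat set \<Rightarrow> nat) \<Rightarrow> nat set" where
  "coloring_code s h = (\<lambda>F. prod_encode (set_encode F, h F)) ` [UNIV]\<^bsup>s\<^esup>"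

definition models_RT :: "nat set set \<Rightarrow> nat \<Rightarrow> nat \<Rightarrow> bool" where
  "models_RT \<M> s l \<longleftrightarrow>
     (\<forall>k. \<forall>h \<in> [UNIV]\<^bsup>s\<^esup> \<rightarrow> {..<k}. coloring_code s h \<in> \<M> \<longrightarrow>
        (\<exists>H\<in>\<M>. infinite H \<and> card (h ` [H]\<^bsup>s\<^esup>) \<le> l))"


section \<open>The bound\<close>

definition Dec :: "nat \<Rightarrow> nat list set" where
  "Dec n = {\<sigma>. \<sigma> \<noteq> [] \<and> set \<sigma> \<subseteq> {1..<n} \<and> sorted_wrt (>) \<sigma>}"

lemma finite_Dec: "finite (Dec n)"
proof (rule finite_subset)
  show "Dec n \<subseteq> {\<sigma>. set \<sigma> \<subseteq> {1..<n} \<and> distinct \<sigma>}"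
    by (auto simp: Dec_def distinct_conv_nth sorted_wrt_iff_nth_less) (metis linorder_neqE_nat less_irrefl)
  show "finite {\<sigma>. set \<sigma> \<subseteq> {1..<n} \<and> distinct \<sigma>}"
    by (rule finite_subset_distinct) simp
qed

definition ell_vec :: "(nat \<Rightarrow> nat) \<Rightarrow> nat \<Rightarrow> nat list \<Rightarrow> nat" where
  "ell_vec l n \<sigma> = l (n - \<sigma> ! 0) * (\<Prod>i\<in>{1..<length \<sigma>}. l (\<sigma> ! (i - 1) - \<sigma> ! i))"

end

theory Submission
  imports Defs "HOL-Analysis.Function_Topology"
begin

text \<open>
  The solution is a union of finite blocks \<open>E\<^sub>0, E\<^sub>1, \<dots>\<close>, built by Mathias forcing with reservoirs from
  a generic filter of infinite members of \<open>\<M>\<close>; by genericity, every coloring of \<open>s\<close>-element sets that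
  lies in \<open>\<M>\<close> has at most \<open>l s\<close> colors on some reservoir. To every coloring \<open>c\<close> of \<open>s\<close>-element sets, in
  \<open>\<M>\<close> or not, a set \<open>J c\<close> of at most \<open>l s\<close> colors is assigned in advance. An \<open>n\<close>-element subset of the
  solution splits into its part \<open>E\<close> in the last block that it meets and a rest \<open>D\<close> of \<open>t < n\<close> elements,
  and a new block is admitted only if \<open>f (D \<union> E)\<close> always lies in \<open>J (\<lambda>E. f (D \<union> E))\<close>. This set is in turn
  a color of \<open>D\<close>, and the \<open>t\<close>-element sets are treated recursively. The resulting bound
  satisfies \<open>b n = l n + (\<Sum>t=1..<n. l (n - t) * b t)\<close>, which unfolds to the sum over \<open>Dec n\<close>.

  The assignment has to leave every requirement satisfiable. Given finitely many colorings, suppose that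
  each of the finitely many assignments is stuck at some requirement, and ask whether for all tuples
  of colorings there are an assignment and a block admitted by it that computes the value \<open>v\<close> at \<open>x\<close>. If
  so, \<open>v\<close> is not wrong, as the given colorings show. If not, then there is a tuple of colorings in the
  Scott set \<open>\<M>\<close> without such a block, it becomes compatible with one of the assignments on some reservoir,
  and hence \<open>v\<close> is not right. The question is \<open>\<Sigma>\<^sub>1\<close>, so \<open>B\<close> would belong to \<open>\<M>\<close>. Compactness yields one
  assignment for all colorings.
\<close>

section \<open>Turing computability\<close>

abbreviation pi1 :: "nat \<Rightarrow> nat" where "pi1 z \<equiv> fst (prod_decode z)"
abbreviation pi2 :: "nat \<Rightarrow> nat" where "pi2 z \<equiv> snd (prod_decode z)"

section \<open>Total functions of one, two and three arguments\<close>

lemma eval_Comp1: "eval A q xs y \<Longrightarrow> eval A p [y] z \<Longrightarrow> eval A (Comp p [q]) xs z"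
  by (rule eval.comp[where ys="[y]"]) auto

lemma eval_Comp2:
  "eval A q xs y \<Longrightarrow> eval A q' xs y' \<Longrightarrow> eval A p [y, y'] z \<Longrightarrow> eval A (Comp p [q, q']) xs z"
  by (rule eval.comp[where ys="[y, y']"]) auto

lemma eval_Proj: "i < length xs \<Longrightarrow> y = xs ! i \<Longrightarrow> eval A (Proj i) xs y"
  by (simp add: eval.proj)

text \<open>Small fixed arities are enough: two and three arguments serve composition and primitive
  recursion, and longer tuples are packed into one number.\<close>

definition rec1 :: "nat set \<Rightarrow> (nat \<Rightarrow> nat) \<Rightarrow> bool" where
  "rec1 A f \<longleftrightarrow> (\<exists>p. \<forall>x. eval A p [x] (f x))"

definition rec2 :: "nat set \<Rightarrow> (nat \<Rightarrow> nat \<Rightarrow> nat) \<Rightarrow> bool" where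
  "rec2 A f \<longleftrightarrow> (\<exists>p. \<forall>x y. eval A p [x, y] (f x y))"

definition rec3 :: "nat set \<Rightarrow> (nat \<Rightarrow> nat \<Rightarrow> nat \<Rightarrow> nat) \<Rightarrow> bool" where
  "rec3 A f \<longleftrightarrow> (\<exists>p. \<forall>x y z. eval A p [x, y, z] (f x y z))"

lemma rec1_id: "rec1 A (\<lambda>x. x)"
  unfolding rec1_def by (rule exI[of _ "Proj 0"]) (auto intro: eval_Proj)

lemma rec2_proj: "rec2 A (\<lambda>x y. x)" "rec2 A (\<lambda>x y. y)"
  unfolding rec2_def
  by (rule exI[of _ "Proj 0"], auto intro: eval_Proj) (rule exI[of _ "Proj 1"], auto intro: eval_Proj)

lemma rec3_proj: "rec3 A (\<lambda>x y z. x)" "rec3 A (\<lambda>x y z. y)" "rec3 A (\<lambda>x y z. z)"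
  unfolding rec3_def
  by (rule exI[of _ "Proj 0"], auto intro: eval_Proj)
     (rule exI[of _ "Proj 1"], auto intro: eval_Proj, rule exI[of _ "Proj 2"], auto intro: eval_Proj)

lemma rec1_Suc: "rec1 A Suc"
  unfolding rec1_def by (rule exI[of _ Succ]) (auto intro: eval.succ)

lemma rec1_comp1: "rec1 A f \<Longrightarrow> rec1 A g \<Longrightarrow> rec1 A (\<lambda>x. f (g x))"
  unfolding rec1_def by (meson eval_Comp1)

lemma rec2_comp1: "rec1 A f \<Longrightarrow> rec2 A g \<Longrightarrow> rec2 A (\<lambda>x y. f (g x y))"
  unfolding rec1_def rec2_def by (meson eval_Comp1)

lemma rec3_comp1: "rec1 A f \<Longrightarrow> rec3 A g \<Longrightarrow> rec3 A (\<lambda>x y z. f (g x y z))"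
  unfolding rec1_def rec3_def by (meson eval_Comp1)

lemma rec1_comp2: "rec2 A f \<Longrightarrow> rec1 A g \<Longrightarrow> rec1 A h \<Longrightarrow> rec1 A (\<lambda>x. f (g x) (h x))"
  unfolding rec1_def rec2_def by (meson eval_Comp2)

lemma rec2_comp2: "rec2 A f \<Longrightarrow> rec2 A g \<Longrightarrow> rec2 A h \<Longrightarrow> rec2 A (\<lambda>x y. f (g x y) (h x y))"
  unfolding rec2_def by (meson eval_Comp2)

lemma rec3_comp2:
  "rec2 A f \<Longrightarrow> rec3 A g \<Longrightarrow> rec3 A h \<Longrightarrow> rec3 A (\<lambda>x y z. f (g x y z) (h x y z))"
  unfolding rec2_def rec3_def by (meson eval_Comp2)

lemma rec1_const: "rec1 A (\<lambda>x. c)"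
proof (induction c)
  case 0
  show ?case unfolding rec1_def by (rule exI[of _ Zero]) (auto intro: eval.zero)
next
  case (Suc c)
  show ?case by (rule rec1_comp1[OF rec1_Suc Suc])
qed

lemma rec2_prim:
  assumes "rec1 A b" "rec3 A g"
  shows "rec2 A (\<lambda>n y. rec_nat (b y) (\<lambda>m r. g m r y) n)"
proof -
  obtain p q where p: "\<And>y. eval A p [y] (b y)" and q: "\<And>m r y. eval A q [m, r, y] (g m r y)"
    using assms unfolding rec1_def rec3_def by blast
  have "eval A (PrimRec p q) [n, y] (rec_nat (b y) (\<lambda>m r. g m r y) n)" for n y
    by (induction n) (auto intro: eval.primrec_0 eval.primrec_Suc p q)
  then show ?thesis unfolding rec2_def by blast
qed

lemma rec1_diag: "rec2 A f \<Longrightarrow> rec1 A (\<lambda>x. f x x)"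
  by (rule rec1_comp2[OF _ rec1_id rec1_id])

lemma rec2_add: "rec2 A (+)"
proof -
  have "rec_nat y (\<lambda>m. Suc) n = n + y" for n y
    by (induction n) auto
  then show ?thesis
    using rec2_prim[OF rec1_id[of A] rec3_comp1[OF rec1_Suc rec3_proj(2)]] by simp
qed

lemma rec2_mult: "rec2 A (\<lambda>x y. x * y)"
proof -
  have "rec_nat 0 (\<lambda>m r. r + y) n = n * y" for n y :: nat
    by (induction n) auto
  then show ?thesis
    using rec2_prim[OF rec1_const[of A 0] rec3_comp2[OF rec2_add rec3_proj(2,3)]] by simp
qed

lemma rec1_pred: "rec1 A (\<lambda>x. x - 1)"
proof -
  have "rec_nat 0 (\<lambda>m r. m) n = n - 1" for n :: nat
    by (cases n) auto
  then show ?thesis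
    using rec1_diag[OF rec2_prim[OF rec1_const[of A 0] rec3_proj(1)]] by simp
qed

lemma rec2_diff: "rec2 A (-)"
proof -
  have "rec_nat y (\<lambda>m r. r - 1) n = y - n" for n y :: nat
    by (induction n) auto
  then have "rec2 A (\<lambda>n y. y - n)"
    using rec2_prim[OF rec1_id[of A] rec3_comp1[OF rec1_pred rec3_proj(2)]] by simp
  from rec2_comp2[OF this rec2_proj(2,1)] show ?thesis by simp
qed

lemma rec1_triangle: "rec1 A triangle"
proof -
  have "rec_nat 0 (\<lambda>m r. r + Suc m) n = triangle n" for n :: nat
    by (induction n) auto
  then show ?thesis
    using rec1_diag[OF rec2_prim[OF rec1_const[of A 0]
          rec3_comp2[OF rec2_add rec3_proj(2) rec3_comp1[OF rec1_Suc rec3_proj(1)]]]] by simp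
qed

lemma rec2_prod_encode: "rec2 A (\<lambda>x y. prod_encode (x, y))"
  unfolding prod_encode_def prod.case
  by (rule rec2_comp2[OF rec2_add rec2_comp1[OF rec1_triangle rec2_add] rec2_proj(1)])

text \<open>
  Unlike the two projections, their sum satisfies a primitive recursion in its own previous value
  alone, and it determines both of them.
\<close>

definition diag_index :: "nat \<Rightarrow> nat" where
  "diag_index z = pi1 z + pi2 z"

text \<open>Since \<open>prod_encode (a, b)\<close> is \<open>triangle (a + b) + a\<close>, the
  diagonal index yields the first component by one subtraction and the second by another.\<close>

lemma prod_decode_eq_diag: "prod_decode z = (z - triangle (diag_index z), diag_index z - (z - triangle (diag_index z)))"
proof -
  obtain a b where z: "z = prod_encode (a, b)" by (metis prod_decode_inverse surj_pair)
  then have "diag_index z = a + b" "prod_decode z = (a, b)" by (simp_all add: diag_index_def)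
  moreover have "z - triangle (a + b) = a" by (simp add: z prod_encode_def)
  ultimately show ?thesis by simp
qed

text \<open>The pairing runs through the diagonals one after another, and diagonal \<open>d\<close>
  starts at the code \<open>triangle d\<close>. The index grows exactly when the next code starts a
  diagonal.\<close>

lemma diag_index_Suc:
  "diag_index (Suc z) = (if triangle (Suc (diag_index z)) = Suc z then Suc (diag_index z) else diag_index z)"
proof -
  obtain a b where z: "z = prod_encode (a, b)" by (metis prod_decode_inverse surj_pair)
  show ?thesis
  proof (cases b)
    case 0
    then have "Suc z = prod_encode (0, Suc a)" by (simp add: z prod_encode_def)
    moreover have "triangle (Suc a) = Suc z" using 0 by (simp add: z prod_encode_def)
    ultimately show ?thesis using 0 by (simp add: diag_index_def z)
  next
    case (Suc b')
    then have "Suc z = prod_encode (Suc a, b')" by (simp add: z prod_encode_def)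
    moreover have "triangle (Suc (a + b)) \<noteq> Suc z" using Suc by (simp add: z prod_encode_def)
    ultimately show ?thesis using Suc by (simp add: diag_index_def z)
  qed
qed

lemma rec1_diag_index: "rec1 A diag_index"
proof -
  \<comment> \<open>With truncated subtraction, \<open>1 - ((a - b) + (b - a))\<close> is 1 if
    \<open>a = b\<close> and 0 otherwise. This turns the case distinction into arithmetic.\<close>
  let ?g = "\<lambda>m r y :: nat. r + (1 - ((triangle (Suc r) - Suc m) + (Suc m - triangle (Suc r))))"
  have d0: "diag_index 0 = 0" by (simp add: diag_index_def prod_decode_def prod_decode_aux.simps)
  have "rec_nat 0 (\<lambda>m r. ?g m r y) n = diag_index n" for n y :: nat
    by (induction n) (auto simp: d0 diag_index_Suc simp del: triangle_Suc)
  moreover have "rec3 A ?g"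
    by (intro rec3_comp2[OF rec2_add] rec3_comp2[OF rec2_diff] rec3_proj
        rec3_comp1[OF rec1_triangle] rec3_comp1[OF rec1_Suc] rec3_comp1[OF rec1_const[of A 1], OF rec3_proj(1)])
  ultimately show ?thesis
    using rec1_diag[OF rec2_prim[OF rec1_const[of A 0]]] by fastforce
qed

lemma rec1_pi1: "rec1 A pi1"
  and rec1_pi2: "rec1 A pi2"
proof -
  have *: "rec1 A (\<lambda>z. z - triangle (diag_index z))"
    by (intro rec1_comp2[OF rec2_diff] rec1_id rec1_comp1[OF rec1_triangle] rec1_diag_index)
  have **: "rec1 A (\<lambda>z. diag_index z - (z - triangle (diag_index z)))"
    by (intro rec1_comp2[OF rec2_diff] * rec1_diag_index)
  show "rec1 A pi1" "rec1 A pi2"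
    using * ** by (subst prod_decode_eq_diag, simp)+
qed

text \<open>The step function receives parameter, counter and previous value packed into one number,
  so that the closure rules can be stated for unary functions.\<close>

lemma rec1_rec_nat:
  assumes "rec1 A f" "rec1 A h" "rec1 A (\<lambda>z. g (pi1 z) (pi1 (pi2 z)) (pi2 (pi2 z)))"
  shows "rec1 A (\<lambda>x. rec_nat (f x) (\<lambda>m r. g x m r) (h x))"
proof -
  have "rec3 A (\<lambda>m r y. prod_encode (y, prod_encode (m, r)))"
    by (intro rec3_comp2[OF rec2_prod_encode] rec3_proj)
  from rec3_comp1[OF assms(3) this] have "rec3 A (\<lambda>m r y. g y m r)" by simp
  from rec1_comp2[OF rec2_prim[OF assms(1) this] assms(2) rec1_id] show ?thesis .
qed

lemma rec1_Least:
  assumes g: "rec1 A (\<lambda>z. g (pi1 z) (pi2 z))" and ex: "\<And>x. \<exists>y. g x y = 0"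
  shows "rec1 A (\<lambda>x. LEAST y. g x y = 0)"
proof -
  have "rec2 A (\<lambda>y x. prod_encode (x, y))"
    by (rule rec2_comp2[OF rec2_prod_encode rec2_proj(2,1)])
  from rec2_comp1[OF g this] obtain p where p: "\<And>x y. eval A p [y, x] (g x y)"
    unfolding rec2_def by auto
  have "eval A (Mu p) [x] (LEAST y. g x y = 0)" for x
  proof (rule eval.mu)
    show "eval A p [LEAST y. g x y = 0, x] 0"
      using p[of "LEAST y. g x y = 0" x] LeastI_ex[OF ex[of x]] by simp
  next
    fix j assume "j < (LEAST y. g x y = 0)"
    then have "g x j \<noteq> 0" by (rule not_less_Least)
    then show "\<exists>y. eval A p [j, x] (Suc y)" using p[of j x] by (metis not0_implies_Suc)
  qed
  then show ?thesis unfolding rec1_def by blast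
qed

section \<open>Change of oracle and the use of a computation\<close>

lemma turing_reducible_iff: "B \<le>\<^sub>T A \<longleftrightarrow> rec1 A (\<lambda>x. of_bool (x \<in> B))"
  unfolding turing_reducible_def rec1_def by (simp add: of_bool_def)

text \<open>Transitivity of reducibility on the level of programs: a program \<open>q\<close> that
  decides the old oracle replaces every query to it.\<close>

fun subst_query :: "prog \<Rightarrow> prog \<Rightarrow> prog" where
  "subst_query q Query = q"
| "subst_query q (Comp f gs) = Comp (subst_query q f) (map (subst_query q) gs)"
| "subst_query q (PrimRec f g) = PrimRec (subst_query q f) (subst_query q g)"
| "subst_query q (Mu f) = Mu (subst_query q f)"
| "subst_query q p = p"

lemma eval_subst_query:
  assumes q: "\<And>x. eval A q [x] (if x \<in> C then 1 else 0)"
  shows "eval C p xs y \<Longrightarrow> eval A (subst_query q p) xs y"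
proof (induction rule: eval.induct)
  case (comp xs gs ys f z)
  have "list_all2 (\<lambda>g y. eval A g xs y) (map (subst_query q) gs) ys"
    using comp.IH(1) by (simp add: list_all2_conv_all_nth)
  then show ?case using comp.IH(2) by (auto intro: eval.comp)
next
  case (mu f m xs)
  then show ?case by (auto intro!: eval.mu)
qed (auto simp: q intro: eval.intros)

lemma rec1_trans:
  assumes "rec1 C f" "C \<le>\<^sub>T A"
  shows "rec1 A f"
proof -
  from assms obtain p q where "\<And>x. eval C p [x] (f x)" "\<And>x. eval A q [x] (if x \<in> C then 1 else 0)"
    unfolding rec1_def turing_reducible_def by blast
  then show ?thesis unfolding rec1_def using eval_subst_query by blast
qed

lemma turing_reducible_refl: "A \<le>\<^sub>T A"
  unfolding turing_reducible_def by (rule exI[of _ Query]) (blast intro: eval.query)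

lemma join_left: "A \<le>\<^sub>T A \<oplus>\<^sub>T B" and join_right: "B \<le>\<^sub>T A \<oplus>\<^sub>T B"
proof -
  let ?J = "A \<oplus>\<^sub>T B"
  have q: "rec1 ?J (\<lambda>x. of_bool (x \<in> ?J))"
    using turing_reducible_refl turing_reducible_iff by blast
  have l: "2 * x \<in> ?J \<longleftrightarrow> x \<in> A" and r: "2 * x + 1 \<in> ?J \<longleftrightarrow> x \<in> B" for x
    unfolding turing_join_def by (auto, presburger+)
  have d: "rec1 ?J (\<lambda>x. 2 * x)"
    by (intro rec1_comp2[OF rec2_mult] rec1_const rec1_id)
  have "rec1 ?J (\<lambda>x. 2 * x + 1)"
    by (intro rec1_comp2[OF rec2_add] rec1_const d)
  from rec1_comp1[OF q d] rec1_comp1[OF q this]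
  show "A \<le>\<^sub>T ?J" "B \<le>\<^sub>T ?J" unfolding turing_reducible_iff l r .
qed

text \<open>A halting computation asks only finitely many oracle questions. A bound for a composite
  computation is the sum of the bounds of its parts, which dominates each of them.\<close>

lemma eval_use:
  assumes "eval A p xs y"
  shows "\<exists>b. \<forall>A'. (\<forall>x<b. x \<in> A' \<longleftrightarrow> x \<in> A) \<longrightarrow> eval A' p xs y"
  using assms
proof (induction rule: eval.induct)
  case (query x)
  show ?case
  proof (intro exI allI impI)
    fix A' assume "\<forall>z<Suc x. z \<in> A' \<longleftrightarrow> z \<in> A"
    then have "x \<in> A' \<longleftrightarrow> x \<in> A" by simp
    then show "eval A' Query [x] (if x \<in> A then 1 else 0)" using eval.query[of A' x] by simp
  qed
next
  case (comp xs gs ys f z)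
  have "\<forall>i<length gs. \<exists>b. \<forall>A'. (\<forall>x<b. x \<in> A' \<longleftrightarrow> x \<in> A) \<longrightarrow> eval A' (gs ! i) xs (ys ! i)"
    using comp.IH(1) by (simp add: list_all2_conv_all_nth)
  then obtain b where b: "\<And>i A'. i < length gs \<Longrightarrow> (\<forall>x<b i. x \<in> A' \<longleftrightarrow> x \<in> A) \<Longrightarrow> eval A' (gs ! i) xs (ys ! i)"
    by metis
  obtain c where c: "\<And>A'. (\<forall>x<c. x \<in> A' \<longleftrightarrow> x \<in> A) \<Longrightarrow> eval A' f ys z"
    using comp.IH(2) by blast
  have le: "length gs = length ys" using comp.IH(1) list_all2_lengthD by blast
  show ?case
  proof (intro exI allI impI)
    fix A' assume *: "\<forall>x<c + (\<Sum>i<length gs. b i). x \<in> A' \<longleftrightarrow> x \<in> A"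
    have "b i \<le> (\<Sum>i<length gs. b i)" if "i < length gs" for i
      using that by (intro member_le_sum) auto
    then have "eval A' (gs ! i) xs (ys ! i)" if "i < length gs" for i
      using b[OF that, of A'] * that by (meson order_less_le_trans trans_le_add2)
    then have "list_all2 (\<lambda>g y. eval A' g xs y) gs ys" using le by (simp add: list_all2_conv_all_nth)
    moreover have "eval A' f ys z" using * c by simp
    ultimately show "eval A' (Comp f gs) xs z" by (rule eval.comp)
  qed
next
  case (primrec_Suc f g m xs r y)
  then obtain b c where "\<And>A'. (\<forall>x<b. x \<in> A' \<longleftrightarrow> x \<in> A) \<Longrightarrow> eval A' (PrimRec f g) (m # xs) r"
    "\<And>A'. (\<forall>x<c. x \<in> A' \<longleftrightarrow> x \<in> A) \<Longrightarrow> eval A' g (m # r # xs) y" by blast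
  then have "\<forall>A'. (\<forall>x<b + c. x \<in> A' \<longleftrightarrow> x \<in> A) \<longrightarrow> eval A' (PrimRec f g) (Suc m # xs) y"
    by (metis eval.primrec_Suc trans_less_add1 trans_less_add2)
  then show ?case by blast
next
  case (mu f m xs)
  have "\<forall>j<m. \<exists>b y. \<forall>A'. (\<forall>x<b. x \<in> A' \<longleftrightarrow> x \<in> A) \<longrightarrow> eval A' f (j # xs) (Suc y)"
    using mu.IH(2) by blast
  then obtain b where b: "\<And>j A'. j < m \<Longrightarrow> (\<forall>x<b j. x \<in> A' \<longleftrightarrow> x \<in> A) \<Longrightarrow> \<exists>y. eval A' f (j # xs) (Suc y)"
    by metis
  obtain c where c: "\<And>A'. (\<forall>x<c. x \<in> A' \<longleftrightarrow> x \<in> A) \<Longrightarrow> eval A' f (m # xs) 0"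
    using mu.IH(1) by blast
  show ?case
  proof (intro exI allI impI)
    fix A' assume *: "\<forall>x<c + (\<Sum>i<m. b i). x \<in> A' \<longleftrightarrow> x \<in> A"
    have "b i \<le> (\<Sum>i<m. b i)" if "i < m" for i
      using that by (intro member_le_sum) auto
    then have "\<exists>y. eval A' f (i # xs) (Suc y)" if "i < m" for i
      using b[OF that, of A'] * that by (meson order_less_le_trans trans_le_add2)
    moreover have "eval A' f (m # xs) 0" using * c by simp
    ultimately show "eval A' (Mu f) xs m" by (auto intro: eval.mu)
  qed
qed (blast intro: eval.intros)+

section \<open>Decidable and semidecidable predicates of a Turing ideal\<close>

lemma prod_encode_pi[simp]: "prod_encode (pi1 z, pi2 z) = z"
  by simp

lemma less_if_mem_set_decode: "i \<in> set_decode x \<Longrightarrow> i < x"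
proof -
  assume "i \<in> set_decode x"
  then have "x div 2 ^ i \<noteq> 0" by (metis even_zero mem_Collect_eq set_decode_def)
  then have "2 ^ i \<le> x" by (metis div_less not_less)
  then show "i < x" using less_exp[of i] by linarith
qed

text \<open>Reading a bit is expressed with bounded quantifiers and arithmetic, so that its
  decidability follows from the closure rules.\<close>

lemma mem_set_decode_iff: "i \<in> set_decode x \<longleftrightarrow> (\<exists>q\<le>x. \<exists>r<2 ^ i. x = (2 * q + 1) * 2 ^ i + r)"
proof
  assume "i \<in> set_decode x"
  then have "odd (x div 2 ^ i)" by (simp add: set_decode_def)
  then obtain q where q: "x div 2 ^ i = 2 * q + 1" by (rule oddE)
  have "x = (2 * q + 1) * 2 ^ i + x mod 2 ^ i" using q by (metis div_mult_mod_eq)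
  moreover have "q \<le> x" using q div_le_dividend[of x "2 ^ i"] by linarith
  moreover have "x mod 2 ^ i < 2 ^ i" by simp
  ultimately show "\<exists>q\<le>x. \<exists>r<2 ^ i. x = (2 * q + 1) * 2 ^ i + r" by blast
next
  assume "\<exists>q\<le>x. \<exists>r<2 ^ i. x = (2 * q + 1) * 2 ^ i + r"
  then obtain q r where "r < 2 ^ i" "x = (2 * q + 1) * 2 ^ i + r" by blast
  then have "x div 2 ^ i = 2 * q + 1"
    by (intro div_nat_eqI) (simp_all add: algebra_simps)
  then show "i \<in> set_decode x" by (simp add: set_decode_def)
qed

lemma set_encode_less: "A \<subseteq> {..<m} \<Longrightarrow> set_encode A < 2 ^ m"
proof -
  assume "A \<subseteq> {..<m}"
  then have "set_encode A \<le> set_encode {..<m}"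
    unfolding set_encode_def by (intro sum_mono2) auto
  also have "\<dots> < 2 ^ m"
    unfolding set_encode_def by (induction m) (simp_all add: lessThan_Suc)
  finally show ?thesis .
qed

lemma set_encode_mono: "finite B \<Longrightarrow> A \<subseteq> B \<Longrightarrow> set_encode A \<le> set_encode B"
  unfolding set_encode_def by (rule sum_mono2) auto

locale turing_ideal =
  fixes \<M> :: "nat set set"
  assumes ideal_nonempty: "\<M> \<noteq> {}"
    and ideal_closed: "\<And>A B. A \<in> \<M> \<Longrightarrow> B \<le>\<^sub>T A \<Longrightarrow> B \<in> \<M>"
    and ideal_join: "\<And>A B. A \<in> \<M> \<Longrightarrow> B \<in> \<M> \<Longrightarrow> A \<oplus>\<^sub>T B \<in> \<M>"
begin

text \<open>
  All predicates are unary, with tuples coded by \<^const>\<open>prod_encode\<close>: \<open>dec\<close> and \<open>sig\<close> are the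
  predicates that are decidable and \<open>\<Sigma>\<^sub>1\<close> relative to some member of the ideal.
\<close>

definition mrec :: "(nat \<Rightarrow> nat) \<Rightarrow> bool" where
  "mrec f \<longleftrightarrow> (\<exists>A\<in>\<M>. rec1 A f)"

lemma mrec_of_rec1: "(\<And>A. rec1 A f) \<Longrightarrow> mrec f"
  unfolding mrec_def using ideal_nonempty by blast

lemma mrec_lift1: "mrec f \<Longrightarrow> (\<And>A. rec1 A f \<Longrightarrow> rec1 A h) \<Longrightarrow> mrec h"
  unfolding mrec_def by blast

text \<open>The two functions may need different oracles; the join of these lies in the ideal and
  computes both.\<close>

lemma mrec_lift2:
  assumes "mrec f" "mrec g" "\<And>A. rec1 A f \<Longrightarrow> rec1 A g \<Longrightarrow> rec1 A h"
  shows "mrec h"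
proof -
  obtain A B where AB: "A \<in> \<M>" "B \<in> \<M>" "rec1 A f" "rec1 B g"
    using assms(1,2) unfolding mrec_def by blast
  then have "rec1 (A \<oplus>\<^sub>T B) f" "rec1 (A \<oplus>\<^sub>T B) g"
    using rec1_trans join_left join_right by blast+
  then show ?thesis
    unfolding mrec_def using AB ideal_join assms(3) by blast
qed

lemma mrec_id: "mrec (\<lambda>x. x)"
  by (rule mrec_of_rec1[OF rec1_id])

lemma mrec_const: "mrec (\<lambda>x. c)"
  by (rule mrec_of_rec1[OF rec1_const])

lemma mrec_comp: "mrec f \<Longrightarrow> mrec g \<Longrightarrow> mrec (\<lambda>x. f (g x))"
  by (erule (1) mrec_lift2) (rule rec1_comp1)

lemma mrec_comp_total: "(\<And>A. rec1 A f) \<Longrightarrow> mrec g \<Longrightarrow> mrec (\<lambda>x. f (g x))"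
  by (rule mrec_comp[OF mrec_of_rec1])

lemma mrec_comp_total2: "(\<And>A. rec2 A f) \<Longrightarrow> mrec g \<Longrightarrow> mrec h \<Longrightarrow> mrec (\<lambda>x. f (g x) (h x))"
  by (erule (1) mrec_lift2) (rule rec1_comp2)

lemmas mrec_Suc = mrec_comp_total[OF rec1_Suc]
lemmas mrec_add = mrec_comp_total2[OF rec2_add]
lemmas mrec_mult = mrec_comp_total2[OF rec2_mult]
lemmas mrec_diff = mrec_comp_total2[OF rec2_diff]
lemmas mrec_pair = mrec_comp_total2[OF rec2_prod_encode]
lemmas mrec_pi1 = mrec_comp_total[OF rec1_pi1]
lemmas mrec_pi2 = mrec_comp_total[OF rec1_pi2]

lemma mrec_rec_nat:
  assumes "mrec f" "mrec (\<lambda>z. g (pi1 z) (pi1 (pi2 z)) (pi2 (pi2 z)))" "mrec h"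
  shows "mrec (\<lambda>x. rec_nat (f x) (\<lambda>m r. g x m r) (h x))"
proof -
  have "mrec (\<lambda>z. rec_nat (f (pi1 z)) (\<lambda>m r. g (pi1 z) m r) (pi2 z))"
  proof (rule mrec_lift2[OF assms(1,2)])
    fix A
    assume f: "rec1 A f" and g: "rec1 A (\<lambda>z. g (pi1 z) (pi1 (pi2 z)) (pi2 (pi2 z)))"
    have "rec1 A (\<lambda>z. prod_encode (pi1 (pi1 z), pi2 z))"
      by (intro rec1_comp2[OF rec2_prod_encode] rec1_comp1[OF rec1_pi1] rec1_comp1[OF rec1_pi2] rec1_id)
    from rec1_comp1[OF g this]
    have g': "rec1 A (\<lambda>z. g (pi1 (pi1 z)) (pi1 (pi2 z)) (pi2 (pi2 z)))" by simp
    from rec1_rec_nat[OF rec1_comp1[OF f rec1_pi1] rec1_pi2 this]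
    show "rec1 A (\<lambda>z. rec_nat (f (pi1 z)) (\<lambda>m r. g (pi1 z) m r) (pi2 z))" .
  qed
  from mrec_comp[OF this mrec_pair[OF mrec_id assms(3)]] show ?thesis by simp
qed

definition dec :: "(nat \<Rightarrow> bool) \<Rightarrow> bool" where
  "dec P \<longleftrightarrow> mrec (\<lambda>x. of_bool (P x))"

lemma dec_iff_mem: "dec P \<longleftrightarrow> {x. P x} \<in> \<M>"
proof
  assume "dec P"
  then obtain A where "A \<in> \<M>" "rec1 A (\<lambda>x. of_bool (P x))" unfolding dec_def mrec_def by blast
  then have "{x. P x} \<le>\<^sub>T A" unfolding turing_reducible_iff by simp
  then show "{x. P x} \<in> \<M>" using \<open>A \<in> \<M>\<close> ideal_closed by blast
next
  assume "{x. P x} \<in> \<M>"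
  then show "dec P"
    unfolding dec_def mrec_def using turing_reducible_refl[of "{x. P x}"] turing_reducible_iff by fastforce
qed

lemma dec_subst: "dec P \<Longrightarrow> mrec f \<Longrightarrow> dec (\<lambda>x. P (f x))"
  unfolding dec_def by (rule mrec_comp)

lemma dec_mem: "A \<in> \<M> \<Longrightarrow> mrec f \<Longrightarrow> dec (\<lambda>x. f x \<in> A)"
  using dec_subst[of "\<lambda>x. x \<in> A" f] by (simp add: dec_iff_mem)

lemma dec_const: "dec (\<lambda>x. b)"
  unfolding dec_def by (rule mrec_const)

lemma dec_not: "dec P \<Longrightarrow> dec (\<lambda>x. \<not> P x)"
proof -
  assume "dec P"
  then have "mrec (\<lambda>x. 1 - of_bool (P x))"
    unfolding dec_def by (intro mrec_diff mrec_const)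
  moreover have "(1::nat) - of_bool (P x) = of_bool (\<not> P x)" for x by simp
  ultimately show ?thesis unfolding dec_def by simp
qed

lemma dec_conj: "dec P \<Longrightarrow> dec Q \<Longrightarrow> dec (\<lambda>x. P x \<and> Q x)"
  unfolding dec_def of_bool_conj by (rule mrec_mult)

lemma dec_disj: "dec P \<Longrightarrow> dec Q \<Longrightarrow> dec (\<lambda>x. P x \<or> Q x)"
proof -
  assume "dec P" "dec Q"
  then have "dec (\<lambda>x. \<not> (\<not> P x \<and> \<not> Q x))" by (intro dec_not dec_conj)
  then show ?thesis by simp
qed

lemma dec_imp: "dec P \<Longrightarrow> dec Q \<Longrightarrow> dec (\<lambda>x. P x \<longrightarrow> Q x)"
  unfolding imp_conv_disj by (intro dec_disj dec_not)

lemma dec_less: "mrec f \<Longrightarrow> mrec g \<Longrightarrow> dec (\<lambda>x. f x < g x)"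
proof -
  assume "mrec f" "mrec g"
  then have "mrec (\<lambda>x. 1 - (1 - (g x - f x)))"
    by (intro mrec_diff mrec_const)
  moreover have "1 - (1 - (g x - f x)) = of_bool (f x < g x)" for x by auto
  ultimately show ?thesis unfolding dec_def by simp
qed

lemma dec_le: "mrec f \<Longrightarrow> mrec g \<Longrightarrow> dec (\<lambda>x. f x \<le> g x)"
  unfolding not_less[symmetric] by (intro dec_not dec_less)

lemma dec_eq: "mrec f \<Longrightarrow> mrec g \<Longrightarrow> dec (\<lambda>x. f x = g x)"
  unfolding eq_iff by (intro dec_conj dec_le)

lemma mrec_if: "dec P \<Longrightarrow> mrec f \<Longrightarrow> mrec g \<Longrightarrow> mrec (\<lambda>x. if P x then f x else g x)"
proof -
  assume "dec P" "mrec f" "mrec g"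
  then have "mrec (\<lambda>x. of_bool (P x) * f x + of_bool (\<not> P x) * g x)"
    using dec_not unfolding dec_def by (intro mrec_add mrec_mult) auto
  moreover have "(\<lambda>x. of_bool (P x) * f x + of_bool (\<not> P x) * g x) = (\<lambda>x. if P x then f x else g x)"
    by (rule ext) simp
  ultimately show ?thesis by (rule back_subst)
qed

lemma dec_all_less:
  assumes "mrec h" "dec (\<lambda>z. P (pi1 z) (pi2 z))"
  shows "dec (\<lambda>x. \<forall>y<h x. P x y)"
proof -
  have "rec_nat 1 (\<lambda>m r. r * of_bool (P x m)) n = (of_bool (\<forall>y<n. P x y) :: nat)" for x n
    by (induction n) (auto simp: less_Suc_eq)
  moreover have "mrec (\<lambda>x. rec_nat 1 (\<lambda>m r. r * of_bool (P x m)) (h x))"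
  proof (rule mrec_rec_nat[OF mrec_const _ assms(1)])
    have "mrec (\<lambda>z. prod_encode (pi1 z, pi1 (pi2 z)))"
      by (intro mrec_pair mrec_pi1 mrec_pi2 mrec_id)
    from dec_subst[OF assms(2) this] have "dec (\<lambda>z. P (pi1 z) (pi1 (pi2 z)))" by simp
    then show "mrec (\<lambda>z. pi2 (pi2 z) * of_bool (P (pi1 z) (pi1 (pi2 z))))"
      unfolding dec_def by (intro mrec_mult mrec_pi2 mrec_id)
  qed
  ultimately show ?thesis unfolding dec_def by simp
qed

lemma dec_ex_less:
  assumes "mrec h" "dec (\<lambda>z. P (pi1 z) (pi2 z))"
  shows "dec (\<lambda>x. \<exists>y<h x. P x y)"
  using dec_not[OF dec_all_less[OF assms(1) dec_not[OF assms(2)]]] by simp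

lemma dec_all_le:
  assumes "mrec h" "dec (\<lambda>z. P (pi1 z) (pi2 z))"
  shows "dec (\<lambda>x. \<forall>y\<le>h x. P x y)"
  using dec_all_less[OF mrec_Suc[OF assms(1)] assms(2)] by (simp add: less_Suc_eq_le)

lemma dec_ex_le:
  assumes "mrec h" "dec (\<lambda>z. P (pi1 z) (pi2 z))"
  shows "dec (\<lambda>x. \<exists>y\<le>h x. P x y)"
  using dec_ex_less[OF mrec_Suc[OF assms(1)] assms(2)] by (simp add: less_Suc_eq_le)

lemma mrec_Least:
  assumes "dec (\<lambda>z. P (pi1 z) (pi2 z))" "\<And>x. \<exists>y. P x y"
  shows "mrec (\<lambda>x. LEAST y. P x y)"
proof -
  have "mrec (\<lambda>x. LEAST y. of_bool (\<not> P x y) = (0::nat))"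
    by (rule mrec_lift1[OF dec_not[OF assms(1), unfolded dec_def]])
       (rule rec1_Least, use assms(2) in auto)
  then show ?thesis by simp
qed

lemma mrec_sum:
  assumes "mrec h" "mrec (\<lambda>z. g (pi1 z) (pi2 z))"
  shows "mrec (\<lambda>x. \<Sum>y<h x. g x y)"
proof -
  have "rec_nat 0 (\<lambda>m r. r + g x m) n = (\<Sum>y<n. g x y)" for x n
    by (induction n) auto
  moreover have "mrec (\<lambda>x. rec_nat 0 (\<lambda>m r. r + g x m) (h x))"
  proof (rule mrec_rec_nat[OF mrec_const _ assms(1)])
    have "mrec (\<lambda>z. prod_encode (pi1 z, pi1 (pi2 z)))"
      by (intro mrec_pair mrec_pi1 mrec_pi2 mrec_id)
    from mrec_comp[OF assms(2) this] have "mrec (\<lambda>z. g (pi1 z) (pi1 (pi2 z)))" by simp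
    then show "mrec (\<lambda>z. pi2 (pi2 z) + g (pi1 z) (pi1 (pi2 z)))"
      by (intro mrec_add mrec_pi2 mrec_id)
  qed
  ultimately show ?thesis by simp
qed

lemma mrec_power2: "mrec h \<Longrightarrow> mrec (\<lambda>x. 2 ^ h x)"
proof -
  assume h: "mrec h"
  have "rec_nat 1 (\<lambda>m r. 2 * r) n = (2 ^ n :: nat)" for n
    by (induction n) auto
  moreover have "mrec (\<lambda>x. rec_nat 1 (\<lambda>m r. 2 * r) (h x))"
    by (rule mrec_rec_nat[OF mrec_const _ h]) (intro mrec_mult mrec_const mrec_pi2 mrec_id)
  ultimately show ?thesis by simp
qed

lemmas mrec_basic = mrec_id mrec_const mrec_Suc mrec_add mrec_mult mrec_diff mrec_pair mrec_pi1 mrec_pi2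
  mrec_power2 mrec_if dec_const dec_not dec_conj dec_disj dec_imp dec_less dec_le dec_eq
  dec_all_less dec_ex_less dec_all_le dec_ex_le

lemma dec_set_decode: "mrec f \<Longrightarrow> mrec g \<Longrightarrow> dec (\<lambda>x. f x \<in> set_decode (g x))"
  unfolding mem_set_decode_iff
  by (intro mrec_basic) (erule mrec_comp, intro mrec_basic)+

lemma mrec_card_set_decode: "mrec f \<Longrightarrow> mrec (\<lambda>x. card (set_decode (f x)))"
proof -
  assume f: "mrec f"
  have "card (set_decode d) = (\<Sum>i<d. of_bool (i \<in> set_decode d))" for d
  proof -
    have "set_decode d = {i \<in> {..<d}. i \<in> set_decode d}"
      using less_if_mem_set_decode by auto
    then show ?thesis by (simp add: Collect_conj_eq Int_absorb1 subset_iff less_if_mem_set_decode)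
  qed
  moreover have "mrec (\<lambda>x. \<Sum>i<f x. of_bool (i \<in> set_decode (f x)))"
    by (intro mrec_sum f dec_set_decode[unfolded dec_def] mrec_pi2 mrec_id mrec_comp[OF f] mrec_pi1)
  ultimately show ?thesis by simp
qed

lemma dec_set_decode_subset:
  assumes "mrec f" "mrec g"
  shows "dec (\<lambda>x. set_decode (f x) \<subseteq> set_decode (g x))"
proof -
  have "set_decode d \<subseteq> S \<longleftrightarrow> (\<forall>i<d. i \<in> set_decode d \<longrightarrow> i \<in> S)" for d S
    using less_if_mem_set_decode by blast
  moreover have "dec (\<lambda>x. \<forall>i<f x. i \<in> set_decode (f x) \<longrightarrow> i \<in> set_decode (g x))"
    by (intro mrec_basic dec_set_decode assms mrec_comp[OF assms(1)] mrec_comp[OF assms(2)])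
  ultimately show ?thesis by simp
qed

lemma dec_finite_conj: "finite I \<Longrightarrow> (\<And>i. i \<in> I \<Longrightarrow> dec (P i)) \<Longrightarrow> dec (\<lambda>x. \<forall>i\<in>I. P i x)"
  by (induction rule: finite_induct) (auto intro: dec_const dec_conj)

lemma dec_finite_disj: "finite I \<Longrightarrow> (\<And>i. i \<in> I \<Longrightarrow> dec (P i)) \<Longrightarrow> dec (\<lambda>x. \<exists>i\<in>I. P i x)"
  by (induction rule: finite_induct) (auto intro: dec_const dec_disj)

lemma dec_mem_finite:
  assumes "finite J" "mrec f"
  shows "dec (\<lambda>x. f x \<in> J)"
  using dec_finite_disj[of J "\<lambda>j x. f x = j", OF assms(1) dec_eq[OF assms(2) mrec_const]] by simp

definition sig :: "(nat \<Rightarrow> bool) \<Rightarrow> bool" where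
  "sig P \<longleftrightarrow> (\<exists>R. dec (\<lambda>z. R (pi1 z) (pi2 z)) \<and> P = (\<lambda>x. \<exists>w. R x w))"

section \<open>Closure properties of semidecidable predicates\<close>

lemma sigI: "dec (\<lambda>z. R (pi1 z) (pi2 z)) \<Longrightarrow> sig (\<lambda>x. \<exists>w. R x w)"
  unfolding sig_def by blast

lemma sig_cong: "sig P \<Longrightarrow> (\<And>x. P x \<longleftrightarrow> Q x) \<Longrightarrow> sig Q"
  using ext[of P Q] by auto

lemma sig_dec: "dec P \<Longrightarrow> sig P"
  using sigI[of "\<lambda>x w. P x"] dec_subst[OF _ mrec_pi1[OF mrec_id]] by simp

lemma sig_ex:
  assumes "sig (\<lambda>z. P (pi1 z) (pi2 z))"
  shows "sig (\<lambda>x. \<exists>y. P x y)"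
proof -
  obtain R where R: "dec (\<lambda>z. R (pi1 z) (pi2 z))" "(\<lambda>z. P (pi1 z) (pi2 z)) = (\<lambda>x. \<exists>w. R x w)"
    using assms unfolding sig_def by blast
  have P: "P x y \<longleftrightarrow> (\<exists>w. R (prod_encode (x, y)) w)" for x y
    using fun_cong[OF R(2), of "prod_encode (x, y)"] by simp
  have "mrec (\<lambda>z. prod_encode (prod_encode (pi1 z, pi1 (pi2 z)), pi2 (pi2 z)))"
    by (intro mrec_pair mrec_pi1 mrec_pi2 mrec_id)
  from dec_subst[OF R(1) this]
  have "dec (\<lambda>z. R (prod_encode (pi1 z, pi1 (pi2 z))) (pi2 (pi2 z)))" by simp
  then have "sig (\<lambda>x. \<exists>w. R (prod_encode (x, pi1 w)) (pi2 w))" by (rule sigI)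
  then show ?thesis
  proof (rule sig_cong)
    show "(\<exists>w. R (prod_encode (x, pi1 w)) (pi2 w)) \<longleftrightarrow> (\<exists>y. P x y)" for x
      using exI[of "\<lambda>w. R (prod_encode (x, pi1 w)) (pi2 w)" "prod_encode (_, _)"] unfolding P by auto
  qed
qed

lemma sig_conj:
  assumes "sig P" "sig Q"
  shows "sig (\<lambda>x. P x \<and> Q x)"
proof -
  obtain R S where R: "dec (\<lambda>z. R (pi1 z) (pi2 z))" "P = (\<lambda>x. \<exists>w. R x w)"
    and S: "dec (\<lambda>z. S (pi1 z) (pi2 z))" "Q = (\<lambda>x. \<exists>w. S x w)"
    using assms unfolding sig_def by blast
  have "mrec (\<lambda>z. prod_encode (pi1 z, pi1 (pi2 z)))" "mrec (\<lambda>z. prod_encode (pi1 z, pi2 (pi2 z)))"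
    by (intro mrec_pair mrec_pi1 mrec_pi2 mrec_id)+
  from dec_conj[OF dec_subst[OF R(1) this(1)] dec_subst[OF S(1) this(2)]]
  have "dec (\<lambda>z. R (pi1 z) (pi1 (pi2 z)) \<and> S (pi1 z) (pi2 (pi2 z)))" by simp
  then have "sig (\<lambda>x. \<exists>w. R x (pi1 w) \<and> S x (pi2 w))" by (rule sigI)
  then show ?thesis
  proof (rule sig_cong)
    show "(\<exists>w. R x (pi1 w) \<and> S x (pi2 w)) \<longleftrightarrow> P x \<and> Q x" for x
      using exI[of "\<lambda>w. R x (pi1 w) \<and> S x (pi2 w)" "prod_encode (_, _)"] unfolding R S by auto
  qed
qed

text \<open>Finitely many witnesses have a common bound. An unbounded quantifier over that bound can
  be moved in front, which leaves a decidable matrix.\<close>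

lemma sig_all_less:
  assumes "mrec h" "sig (\<lambda>z. P (pi1 z) (pi2 z))"
  shows "sig (\<lambda>x. \<forall>y<h x. P x y)"
proof -
  obtain R where R: "dec (\<lambda>z. R (pi1 z) (pi2 z))" "(\<lambda>z. P (pi1 z) (pi2 z)) = (\<lambda>x. \<exists>w. R x w)"
    using assms unfolding sig_def by blast
  have P: "P x y \<longleftrightarrow> (\<exists>w. R (prod_encode (x, y)) w)" for x y
    using fun_cong[OF R(2), of "prod_encode (x, y)"] by simp
  have "mrec (\<lambda>z. prod_encode (prod_encode (pi1 (pi1 (pi1 z)), pi2 (pi1 z)), pi2 z))"
    by (intro mrec_pair mrec_pi1 mrec_pi2 mrec_id)
  from dec_subst[OF R(1) this]
  have *: "dec (\<lambda>z. R (prod_encode (pi1 (pi1 (pi1 z)), pi2 (pi1 z))) (pi2 z))" by simp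
  have "sig (\<lambda>x. \<exists>b. \<forall>y<h x. \<exists>w<b. R (prod_encode (x, y)) w)"
    by (intro sigI mrec_basic mrec_comp[OF assms(1)] *)
  then show ?thesis
  proof (rule sig_cong)
    fix x
    show "(\<exists>b. \<forall>y<h x. \<exists>w<b. R (prod_encode (x, y)) w) \<longleftrightarrow> (\<forall>y<h x. P x y)"
    proof
      assume "\<forall>y<h x. P x y"
      then obtain w where w: "\<And>y. y < h x \<Longrightarrow> R (prod_encode (x, y)) (w y)" unfolding P by metis
      have "w y < Suc (\<Sum>y<h x. w y)" if "y < h x" for y
        using that by (intro le_imp_less_Suc member_le_sum) auto
      then show "\<exists>b. \<forall>y<h x. \<exists>w<b. R (prod_encode (x, y)) w" using w by blast
    qed (auto simp: P)
  qed
qed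

text \<open>A search for a witness of either side always ends. Only the true side has witnesses, so
  the kind of the witness found decides the predicate.\<close>

lemma dec_if_sig:
  assumes "sig P" "sig (\<lambda>x. \<not> P x)"
  shows "dec P"
proof -
  obtain R S where R: "dec (\<lambda>z. R (pi1 z) (pi2 z))" "P = (\<lambda>x. \<exists>w. R x w)"
    and S: "dec (\<lambda>z. S (pi1 z) (pi2 z))" "(\<lambda>x. \<not> P x) = (\<lambda>x. \<exists>w. S x w)"
    using assms unfolding sig_def by blast
  have PR: "P x \<longleftrightarrow> (\<exists>w. R x w)" for x using R(2) by simp
  have PS: "\<not> P x \<longleftrightarrow> (\<exists>w. S x w)" for x using fun_cong[OF S(2)] by simp
  define m where "m x = (LEAST w. R x w \<or> S x w)" for x
  have ex: "\<exists>w. R x w \<or> S x w" for x using PR PS by blast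
  have "mrec m" unfolding m_def
    by (intro mrec_Least dec_disj R S ex)
  then have "mrec (\<lambda>x. prod_encode (x, m x))" by (intro mrec_pair mrec_id)
  from dec_subst[OF R(1) this] have "dec (\<lambda>x. R x (m x))" by simp
  moreover have "R x (m x) \<longleftrightarrow> P x" for x
    using LeastI_ex[OF ex[of x], folded m_def] PR PS by blast
  ultimately show ?thesis by simp
qed

end

section \<open>Uniform semidecidability of evaluation\<close>

instance prog :: countable
  by countable_datatype

text \<open>The code 0 stands for the empty list and a successor for a nonempty one, hence the
  subtraction of 1. By truncation the tail of the code 0 is again 0.\<close>

abbreviation hdc :: "nat \<Rightarrow> nat" where "hdc c \<equiv> pi1 (c - 1)"
abbreviation tlc :: "nat \<Rightarrow> nat" where "tlc c \<equiv> pi2 (c - 1)"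
abbreviation consc :: "nat \<Rightarrow> nat \<Rightarrow> nat" where "consc x c \<equiv> Suc (prod_encode (x, c))"

definition dropc :: "nat \<Rightarrow> nat \<Rightarrow> nat" where
  "dropc c i = rec_nat c (\<lambda>m r. tlc r) i"

definition nthc :: "nat \<Rightarrow> nat \<Rightarrow> nat" where
  "nthc c i = hdc (dropc c i)"

lemma prod_decode_0[simp]: "prod_decode 0 = (0, 0)"
  by (simp add: prod_decode_def prod_decode_aux.simps)

lemma list_decode_eq: "list_decode c = (if c = 0 then [] else hdc c # list_decode (tlc c))"
  by (cases c) (auto split: prod.split)

lemma list_decode_consc: "list_decode (consc x c) = x # list_decode c"
  by simp

lemma dropc_Suc: "dropc c (Suc i) = dropc (tlc c) i"
  by (induction i) (simp_all add: dropc_def)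

lemma list_decode_dropc: "list_decode (dropc c i) = drop i (list_decode c)"
proof (induction i arbitrary: c)
  case (Suc i)
  show ?case unfolding dropc_Suc Suc by (subst list_decode_eq[of c]) simp
qed (simp add: dropc_def)

lemma dropc_eq_0_iff: "dropc c i = 0 \<longleftrightarrow> length (list_decode c) \<le> i"
proof -
  have "dropc c i = 0 \<longleftrightarrow> list_decode (dropc c i) = []"
    using list_decode_eq[of "dropc c i"] by auto
  then show ?thesis by (simp add: list_decode_dropc)
qed

lemma nthc_eq: "i < length (list_decode c) \<Longrightarrow> nthc c i = list_decode c ! i"
  using list_decode_dropc[of c i] dropc_eq_0_iff[of c i] list_decode_eq[of "dropc c i"]
  by (simp add: nthc_def Cons_nth_drop_Suc[symmetric])

lemma length_list_decode_le: "length (list_decode c) \<le> c"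
proof (induction c rule: less_induct)
  case (less c)
  show ?case
  proof (cases c)
    case (Suc c')
    have "pi2 c' \<le> c'" by (metis le_prod_encode_2 prod_decode_inverse surjective_pairing)
    then show ?thesis using less[of "pi2 c'"] Suc list_decode_eq[of c] by simp
  qed simp
qed

context turing_ideal
begin

lemma mrec_dropc: "mrec f \<Longrightarrow> mrec g \<Longrightarrow> mrec (\<lambda>x. dropc (f x) (g x))"
  unfolding dropc_def by (intro mrec_rec_nat mrec_basic)

lemma mrec_nthc: "mrec f \<Longrightarrow> mrec g \<Longrightarrow> mrec (\<lambda>x. nthc (f x) (g x))"
  unfolding nthc_def by (intro mrec_dropc mrec_basic)

text \<open>
  Since \<open>\<Sigma>\<^sub>1\<close> predicates are closed under bounded universal quantification, the graph of a program is
  \<open>\<Sigma>\<^sub>1\<close> uniformly in a parameter of the oracle; no universal machine is needed.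
\<close>

lemma sig_eval:
  assumes Or: "dec (\<lambda>z. pi2 z \<in> Or (pi1 z))"
  shows "mrec a \<Longrightarrow> mrec c \<Longrightarrow> mrec y \<Longrightarrow> sig (\<lambda>x. eval (Or (a x)) p (list_decode (c x)) (y x))"
proof (induction p arbitrary: a c y)
  case Zero
  have "sig (\<lambda>x. y x = 0)" by (intro sig_dec mrec_basic Zero)
  then show ?case by (rule sig_cong) (auto intro: eval.zero elim: eval_ZeroE)
next
  case Succ
  have "sig (\<lambda>x. c x \<noteq> 0 \<and> tlc (c x) = 0 \<and> y x = Suc (hdc (c x)))"
    by (intro sig_dec mrec_basic Succ)
  then show ?case
  proof (rule sig_cong)
    fix x
    have "eval A Succ xs v \<longleftrightarrow> (\<exists>u. xs = [u] \<and> v = Suc u)" for A xs v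
      by (auto intro: eval.succ elim: eval_SuccE)
    moreover have "(\<exists>u. list_decode (c x) = [u] \<and> y x = Suc u) \<longleftrightarrow> c x \<noteq> 0 \<and> tlc (c x) = 0 \<and> y x = Suc (hdc (c x))"
      by (subst list_decode_eq, subst list_decode_eq[of "tlc (c x)"]) auto
    ultimately show "(c x \<noteq> 0 \<and> tlc (c x) = 0 \<and> y x = Suc (hdc (c x))) \<longleftrightarrow> eval (Or (a x)) Succ (list_decode (c x)) (y x)"
      by simp
  qed
next
  case (Proj i)
  have "sig (\<lambda>x. dropc (c x) i \<noteq> 0 \<and> y x = nthc (c x) i)"
    by (intro sig_dec mrec_basic mrec_dropc mrec_nthc Proj)
  then show ?case
  proof (rule sig_cong)
    fix x
    have "eval A (Proj i) xs v \<longleftrightarrow> i < length xs \<and> v = xs ! i" for A xs v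
      by (auto intro: eval.proj elim: eval_ProjE)
    then show "(dropc (c x) i \<noteq> 0 \<and> y x = nthc (c x) i) \<longleftrightarrow> eval (Or (a x)) (Proj i) (list_decode (c x)) (y x)"
      by (auto simp: dropc_eq_0_iff nthc_eq)
  qed
next
  case Query
  have "mrec (\<lambda>x. prod_encode (a x, hdc (c x)))"
    by (intro mrec_basic Query)
  from dec_subst[OF Or this] have "dec (\<lambda>x. hdc (c x) \<in> Or (a x))" by simp
  then have "sig (\<lambda>x. c x \<noteq> 0 \<and> tlc (c x) = 0 \<and> y x = (if hdc (c x) \<in> Or (a x) then 1 else 0))"
    by (intro sig_dec mrec_basic Query)
  then show ?case
  proof (rule sig_cong)
    fix x
    have "eval A Query xs v \<longleftrightarrow> (\<exists>u. xs = [u] \<and> v = (if u \<in> A then 1 else 0))" for A xs v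
      by (blast intro: eval.query elim: eval_QueryE)
    moreover have "(\<exists>u. list_decode (c x) = [u] \<and> y x = (if u \<in> Or (a x) then 1 else 0))
       \<longleftrightarrow> c x \<noteq> 0 \<and> tlc (c x) = 0 \<and> y x = (if hdc (c x) \<in> Or (a x) then 1 else 0)"
      by (subst list_decode_eq, subst list_decode_eq[of "tlc (c x)"]) auto
    ultimately show "(c x \<noteq> 0 \<and> tlc (c x) = 0 \<and> y x = (if hdc (c x) \<in> Or (a x) then 1 else 0))
       \<longleftrightarrow> eval (Or (a x)) Query (list_decode (c x)) (y x)"
      by simp
  qed
next
  case (Comp f gs)
  \<comment> \<open>A second induction, along the list \<open>gs\<close>, treats the inner programs;
    \<open>d\<close> codes the list of their values.\<close>
  have *: "mrec d \<Longrightarrow> mrec a \<Longrightarrow> mrec c \<Longrightarrow>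
      sig (\<lambda>x. list_all2 (\<lambda>g y. eval (Or (a x)) g (list_decode (c x)) y) gs (list_decode (d x)))" for d a c
    using Comp.IH(2)
  proof (induction gs arbitrary: d)
    case Nil
    have "sig (\<lambda>x. d x = 0)" by (intro sig_dec mrec_basic Nil)
    then show ?case by (rule sig_cong) (subst list_decode_eq, auto)
  next
    case (Cons g gs)
    have "sig (\<lambda>x. d x \<noteq> 0 \<and> eval (Or (a x)) g (list_decode (c x)) (hdc (d x)) \<and>
        list_all2 (\<lambda>g y. eval (Or (a x)) g (list_decode (c x)) y) gs (list_decode (tlc (d x))))"
      by (rule sig_conj[OF sig_dec sig_conj[OF Cons.prems(4) Cons.IH]])
        (auto intro!: mrec_basic Cons.prems)
    then show ?case by (rule sig_cong) (subst (5) list_decode_eq, auto)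
  qed
  have m: "mrec (\<lambda>z. a (h z))" "mrec (\<lambda>z. c (h z))" "mrec (\<lambda>z. y (h z))" if "mrec h" for h
    using Comp.prems that by (auto intro: mrec_comp)
  have "sig (\<lambda>x. \<exists>d. list_all2 (\<lambda>g y. eval (Or (a x)) g (list_decode (c x)) y) gs (list_decode d)
      \<and> eval (Or (a x)) f (list_decode d) (y x))"
    by (intro sig_ex sig_conj * Comp.IH(1) m mrec_basic)
  then show ?case
  proof (rule sig_cong)
    fix x
    have "eval A (Comp f gs) xs v \<longleftrightarrow> (\<exists>ys. list_all2 (\<lambda>g y. eval A g xs y) gs ys \<and> eval A f ys v)" for A xs v
      using eval.comp[of A xs gs _ f v] eval_CompE[of A f gs xs v] by metis
    then show "(\<exists>d. list_all2 (\<lambda>g y. eval (Or (a x)) g (list_decode (c x)) y) gs (list_decode d)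
        \<and> eval (Or (a x)) f (list_decode d) (y x)) \<longleftrightarrow> eval (Or (a x)) (Comp f gs) (list_decode (c x)) (y x)"
      by (metis list_encode_inverse)
  qed
next
  case (PrimRec f g)
  have m: "mrec (\<lambda>z. a (h z))" "mrec (\<lambda>z. c (h z))" "mrec (\<lambda>z. y (h z))" if "mrec h" for h
    using PrimRec.prems that by (auto intro: mrec_comp)
  \<comment> \<open>The number \<open>s\<close> codes the whole sequence of intermediate values of
    the recursion.\<close>
  have "sig (\<lambda>x. \<exists>s. c x \<noteq> 0 \<and> eval (Or (a x)) f (list_decode (tlc (c x))) (nthc s 0) \<and>
      (\<forall>m<hdc (c x). eval (Or (a x)) g (list_decode (consc m (consc (nthc s m) (tlc (c x))))) (nthc s (Suc m)))
      \<and> y x = nthc s (hdc (c x)))"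
    by (intro sig_ex sig_conj sig_all_less PrimRec.IH sig_dec mrec_basic m mrec_nthc)
  then show ?case
  proof (rule sig_cong)
    fix x
    let ?A = "Or (a x)" and ?n = "hdc (c x)" and ?xs = "list_decode (tlc (c x))"
    have run: "eval A (PrimRec f g) (n # xs) v \<longleftrightarrow> (\<exists>r. eval A f xs (r 0)
        \<and> (\<forall>m<n. eval A g (m # r m # xs) (r (Suc m))) \<and> v = r n)" (is "_ \<longleftrightarrow> ?R n v") for A xs n v
    proof
      show "eval A (PrimRec f g) (n # xs) v \<Longrightarrow> ?R n v"
      proof (induction n arbitrary: v)
        case 0
        then have "eval A f xs v" by (rule eval_PrimRec_0E)
        then show ?case by (intro exI[of _ "\<lambda>_. v"]) simp
      next
        case (Suc n)
        from Suc.prems obtain u where u: "eval A (PrimRec f g) (n # xs) u" "eval A g (n # u # xs) v"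
          by (rule eval_PrimRec_SucE)
        from Suc.IH[OF u(1)] obtain r where "eval A f xs (r 0)"
          "\<forall>m<n. eval A g (m # r m # xs) (r (Suc m))" "u = r n" by blast
        then show ?case using u(2)
          by (intro exI[of _ "r(Suc n := v)"]) (auto simp: less_Suc_eq)
      qed
    next
      assume "?R n v"
      then obtain r where r: "eval A f xs (r 0)" "\<forall>m<n. eval A g (m # r m # xs) (r (Suc m))" "v = r n"
        by blast
      have "m \<le> n \<Longrightarrow> eval A (PrimRec f g) (m # xs) (r m)" for m
        by (induction m) (use r in \<open>auto intro: eval.primrec_0 eval.primrec_Suc\<close>)
      then show "eval A (PrimRec f g) (n # xs) v" using r(3) by simp
    qed
    \<comment> \<open>Only the values up to \<open>?n\<close> matter, and a finite segment of a
      function can be coded by a number.\<close>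
    have seq: "(\<exists>s. Q (nthc s)) \<longleftrightarrow> (\<exists>r. Q r)" if "\<And>r r'. (\<forall>m\<le>?n. r m = r' m) \<Longrightarrow> Q r \<longleftrightarrow> Q r'"
      for Q :: "(nat \<Rightarrow> nat) \<Rightarrow> bool"
    proof
      assume "\<exists>r. Q r"
      then obtain r where "Q r" by blast
      moreover have "\<forall>m\<le>?n. nthc (list_encode (map r [0..<Suc ?n])) m = r m"
        by (auto simp: nthc_eq simp del: upt_Suc)
      ultimately show "\<exists>s. Q (nthc s)" using that by blast
    qed blast
    \<comment> \<open>The empty argument list needs separate care, because the code 0 also has a
      head and a tail.\<close>
    have "\<not> eval ?A (PrimRec f g) [] v" for v
    proof
      assume "eval ?A (PrimRec f g) [] v"
      then show False by cases
    qed
    then have "eval ?A (PrimRec f g) (list_decode (c x)) (y x) \<longleftrightarrow> c x \<noteq> 0 \<and> eval ?A (PrimRec f g) (?n # ?xs) (y x)"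
      by (subst list_decode_eq) auto
    also have "\<dots> \<longleftrightarrow> c x \<noteq> 0 \<and> (\<exists>r. eval ?A f ?xs (r 0)
        \<and> (\<forall>m<?n. eval ?A g (m # r m # ?xs) (r (Suc m))) \<and> y x = r ?n)"
      unfolding run ..
    also have "\<dots> \<longleftrightarrow> c x \<noteq> 0 \<and> (\<exists>s. eval ?A f ?xs (nthc s 0)
        \<and> (\<forall>m<?n. eval ?A g (m # nthc s m # ?xs) (nthc s (Suc m))) \<and> y x = nthc s ?n)"
      by (subst seq[of "\<lambda>r. eval ?A f ?xs (r 0)
        \<and> (\<forall>m<?n. eval ?A g (m # r m # ?xs) (r (Suc m))) \<and> y x = r ?n"]) auto
    finally show "(\<exists>s. c x \<noteq> 0 \<and> eval ?A f ?xs (nthc s 0) \<and>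
        (\<forall>m<?n. eval ?A g (list_decode (consc m (consc (nthc s m) (tlc (c x))))) (nthc s (Suc m)))
        \<and> y x = nthc s ?n) \<longleftrightarrow> eval ?A (PrimRec f g) (list_decode (c x)) (y x)"
      unfolding list_decode_consc by simp
  qed
next
  case (Mu f)
  have m: "mrec (\<lambda>z. a (h z))" "mrec (\<lambda>z. c (h z))" "mrec (\<lambda>z. y (h z))" if "mrec h" for h
    using Mu.prems that by (auto intro: mrec_comp)
  have "sig (\<lambda>x. eval (Or (a x)) f (list_decode (consc (y x) (c x))) 0 \<and>
      (\<forall>j<y x. \<exists>v. eval (Or (a x)) f (list_decode (consc j (c x))) (Suc v)))"
    by (intro sig_ex sig_conj sig_all_less Mu.IH Mu.prems mrec_basic m)
  then show ?case
  proof (rule sig_cong)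
    fix x
    have "eval A (Mu f) xs v \<longleftrightarrow> eval A f (v # xs) 0 \<and> (\<forall>j<v. \<exists>w. eval A f (j # xs) (Suc w))" for A xs v
    proof
      assume "eval A (Mu f) xs v"
      then show "eval A f (v # xs) 0 \<and> (\<forall>j<v. \<exists>w. eval A f (j # xs) (Suc w))"
        by (rule eval_MuE) simp
    qed (simp add: eval.mu)
    then show "(eval (Or (a x)) f (list_decode (consc (y x) (c x))) 0 \<and>
      (\<forall>j<y x. \<exists>v. eval (Or (a x)) f (list_decode (consc j (c x))) (Suc v)))
      \<longleftrightarrow> eval (Or (a x)) (Mu f) (list_decode (c x)) (y x)"
      unfolding list_decode_consc by simp
  qed
qed

end

section \<open>Scott sets and generic filters\<close>

locale scott = turing_ideal +
  assumes scott_path: "\<And>T. binary_tree T \<Longrightarrow> infinite T \<Longrightarrow> tree_code T \<in> \<M> \<Longrightarrow> \<exists>P\<in>\<M>. path_through P T"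
begin

text \<open>
  Think of \<open>W m t\<close> as the enumeration, at stage \<open>m\<close>, of the basic open set of all \<open>P\<close> that agree
  with \<open>set_decode t\<close> below \<open>m\<close>.
\<close>

lemma scott_open:
  assumes W: "dec (\<lambda>z. W (pi1 z) (pi2 z))"
    and mono: "\<And>m t m' t'. W m t \<Longrightarrow> m \<le> m' \<Longrightarrow> (\<forall>i<m. i \<in> set_decode t \<longleftrightarrow> i \<in> set_decode t') \<Longrightarrow> W m' t'"
  shows "(\<exists>m. \<forall>t<2 ^ m. W m t) \<or>
    (\<exists>P\<in>\<M>. \<forall>m t. (\<forall>i<m. i \<in> set_decode t \<longleftrightarrow> i \<in> P) \<longrightarrow> \<not> W m t)"
proof (subst disj_commute, rule disjCI)
  assume no: "\<nexists>m. \<forall>t<2 ^ m. W m t"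
  have Wd: "dec (\<lambda>z. W (f z) (g z))" if "mrec f" "mrec g" for f g
    using dec_subst[OF W mrec_pair[OF that]] by simp
  have bits: "\<exists>t<2 ^ m. set_decode t = {i. i < m \<and> Q i}" for m :: nat and Q
  proof (intro exI conjI)
    show "set_encode {i. i < m \<and> Q i} < 2 ^ m" by (rule set_encode_less) auto
  qed simp
  \<comment> \<open>The strings whose basic open set has not been enumerated by the stage equal to
    their length.\<close>
  define T where "T = {\<sigma>. \<forall>t. (\<forall>i<length \<sigma>. i \<in> set_decode t \<longleftrightarrow> \<sigma> ! i) \<longrightarrow> \<not> W (length \<sigma>) t}"
  \<comment> \<open>By \<open>mono\<close>, all \<open>t\<close> with the same bits below the length
    behave alike. The universal quantifier thus becomes a bounded existential one, which makes the
    tree decidable.\<close>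
  have T_iff: "\<sigma> \<in> T \<longleftrightarrow> (\<exists>t<2 ^ length \<sigma>. (\<forall>i<length \<sigma>. i \<in> set_decode t \<longleftrightarrow> \<sigma> ! i) \<and> \<not> W (length \<sigma>) t)" for \<sigma>
  proof
    assume "\<sigma> \<in> T"
    then show "\<exists>t<2 ^ length \<sigma>. (\<forall>i<length \<sigma>. i \<in> set_decode t \<longleftrightarrow> \<sigma> ! i) \<and> \<not> W (length \<sigma>) t"
      using bits[of "length \<sigma>" "\<lambda>i. \<sigma> ! i"] unfolding T_def by auto
  next
    assume "\<exists>t<2 ^ length \<sigma>. (\<forall>i<length \<sigma>. i \<in> set_decode t \<longleftrightarrow> \<sigma> ! i) \<and> \<not> W (length \<sigma>) t"
    then obtain t where t: "\<forall>i<length \<sigma>. i \<in> set_decode t \<longleftrightarrow> \<sigma> ! i" "\<not> W (length \<sigma>) t" by blast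
    show "\<sigma> \<in> T" unfolding T_def
    proof (intro CollectI allI impI notI)
      fix u assume u: "\<forall>i<length \<sigma>. i \<in> set_decode u \<longleftrightarrow> \<sigma> ! i" "W (length \<sigma>) u"
      have "W (length \<sigma>) t" by (rule mono[OF u(2) order_refl]) (use u(1) t(1) in simp)
      then show False using t(2) by simp
    qed
  qed
  have "binary_tree T"
    unfolding binary_tree_def
  proof (intro ballI allI impI)
    fix \<sigma> \<tau> assume \<sigma>: "\<sigma> \<in> T" and "prefix \<tau> \<sigma>"
    then obtain \<rho> where \<rho>: "\<sigma> = \<tau> @ \<rho>" by (auto elim: prefixE)
    obtain t where t: "\<forall>i<length \<sigma>. i \<in> set_decode t \<longleftrightarrow> \<sigma> ! i" "\<not> W (length \<sigma>) t"
      using iffD1[OF T_iff \<sigma>] by blast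
    show "\<tau> \<in> T"
      unfolding T_def
    proof (intro CollectI allI impI notI)
      fix u assume u: "\<forall>i<length \<tau>. i \<in> set_decode u \<longleftrightarrow> \<tau> ! i" "W (length \<tau>) u"
      have "\<forall>i<length \<tau>. i \<in> set_decode u \<longleftrightarrow> i \<in> set_decode t"
        using u(1) t(1) by (simp add: \<rho> nth_append)
      then have "W (length \<sigma>) t" by (intro mono[OF u(2)]) (simp_all add: \<rho>)
      then show False using t(2) by simp
    qed
  qed
  moreover have "infinite T"
  proof
    assume "finite T"
    moreover have "length ` T = UNIV"
    proof (intro equalityI subset_UNIV subsetI)
      fix m :: nat
      obtain t where t: "t < 2 ^ m" "\<not> W m t" using no by blast
      then have "map (\<lambda>i. i \<in> set_decode t) [0..<m] \<in> T"
        unfolding T_iff by (intro exI[of _ t]) simp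
      then show "m \<in> length ` T" by force
    qed
    ultimately show False using infinite_UNIV_nat by (metis finite_imageI)
  qed
  moreover have "tree_code T \<in> \<M>"
  proof -
    \<comment> \<open>The conditions on \<open>dropc\<close> force \<open>m\<close> to be the length
      of the list coded by \<open>z\<close>; a code is never smaller than that length.\<close>
    have "dec (\<lambda>z. \<exists>m\<le>z. dropc z m = 0 \<and> (\<forall>i<m. dropc z i \<noteq> 0) \<and> (\<forall>i<m. nthc z i \<le> 1)
        \<and> (\<exists>t<2 ^ m. (\<forall>i<m. (i \<in> set_decode t \<longrightarrow> nthc z i = 1) \<and> (nthc z i = 1 \<longrightarrow> i \<in> set_decode t)) \<and> \<not> W m t))"
      by (intro mrec_basic mrec_dropc mrec_nthc dec_set_decode Wd)
    moreover have "(\<exists>m\<le>z. dropc z m = 0 \<and> (\<forall>i<m. dropc z i \<noteq> 0) \<and> (\<forall>i<m. nthc z i \<le> 1)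
        \<and> (\<exists>t<2 ^ m. (\<forall>i<m. (i \<in> set_decode t \<longrightarrow> nthc z i = 1) \<and> (nthc z i = 1 \<longrightarrow> i \<in> set_decode t)) \<and> \<not> W m t))
        \<longleftrightarrow> z \<in> tree_code T" (is "?L \<longleftrightarrow> _") for z
    proof
      assume ?L
      then obtain m t where m: "dropc z m = 0" "\<forall>i<m. dropc z i \<noteq> 0" "\<forall>i<m. nthc z i \<le> 1"
        and t: "t < 2 ^ m" "\<forall>i<m. i \<in> set_decode t \<longleftrightarrow> nthc z i = 1" "\<not> W m t" by blast
      have "length (list_decode z) \<le> m" using m(1) dropc_eq_0_iff by blast
      moreover have "\<not> length (list_decode z) < m" using m(2) dropc_eq_0_iff by blast
      ultimately have len: "length (list_decode z) = m" by simp
      define \<sigma> where "\<sigma> = map (\<lambda>v. v = 1) (list_decode z)"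
      have "map of_bool \<sigma> = list_decode z"
      proof (rule nth_equalityI)
        fix i assume "i < length (map of_bool \<sigma> :: nat list)"
        then have i: "i < length (list_decode z)" "i < m" by (simp_all add: \<sigma>_def len)
        have "nthc z i \<le> 1" using m(3) i(2) by blast
        then have "list_decode z ! i \<le> 1" unfolding nthc_eq[OF i(1)] .
        then show "map of_bool \<sigma> ! i = list_decode z ! i"
          using i(1) by (cases "list_decode z ! i = 1") (simp_all add: \<sigma>_def)
      qed (simp add: \<sigma>_def)
      then have "z = list_encode (map of_bool \<sigma>)" by simp
      moreover have "\<sigma> \<in> T"
      proof -
        have "\<forall>i<m. i \<in> set_decode t \<longleftrightarrow> \<sigma> ! i"
          using t(2) nthc_eq[of _ z] by (simp add: \<sigma>_def len)
        then show ?thesis unfolding T_iff using t(1,3) by (auto simp: \<sigma>_def len)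
      qed
      ultimately show "z \<in> tree_code T" unfolding tree_code_def by blast
    next
      assume "z \<in> tree_code T"
      then obtain \<sigma> where \<sigma>: "\<sigma> \<in> T" "z = list_encode (map of_bool \<sigma>)" unfolding tree_code_def by blast
      then have d: "list_decode z = map of_bool \<sigma>" by simp
      have n: "nthc z i = of_bool (\<sigma> ! i)" if "i < length \<sigma>" for i
        using that nthc_eq[of i z] by (simp add: d)
      obtain t where t: "t < 2 ^ length \<sigma>" "\<forall>i<length \<sigma>. i \<in> set_decode t \<longleftrightarrow> \<sigma> ! i" "\<not> W (length \<sigma>) t"
        using iffD1[OF T_iff \<sigma>(1)] by blast
      have "length \<sigma> \<le> z" using length_list_decode_le[of z] by (simp add: d)
      moreover have "dropc z (length \<sigma>) = 0" "\<forall>i<length \<sigma>. dropc z i \<noteq> 0"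
        by (simp_all add: dropc_eq_0_iff d)
      moreover have "\<forall>i<length \<sigma>. nthc z i \<le> 1" by (simp add: n)
      moreover have "\<forall>i<length \<sigma>. (i \<in> set_decode t \<longrightarrow> nthc z i = 1) \<and> (nthc z i = 1 \<longrightarrow> i \<in> set_decode t)"
        using t(2) by (simp add: n)
      ultimately show ?L using t by blast
    qed
    ultimately show ?thesis by (simp add: dec_iff_mem)
  qed
  ultimately obtain P where P: "P \<in> \<M>" "path_through P T" using scott_path by blast
  have "\<not> W m t" if "\<forall>i<m. i \<in> set_decode t \<longleftrightarrow> i \<in> P" for m t
  proof -
    have "map (\<lambda>i. i \<in> P) [0..<m] \<in> T" using P(2) unfolding path_through_def by blast
    then show ?thesis unfolding T_def using that by auto
  qed
  then show "\<exists>P\<in>\<M>. \<forall>m t. (\<forall>i<m. i \<in> set_decode t \<longleftrightarrow> i \<in> P) \<longrightarrow> \<not> W m t"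
    using P(1) by blast
qed

section \<open>Thinning reservoirs and the generic filter\<close>

lemma mrec_enumerate:
  assumes "X \<in> \<M>" "infinite X"
  shows "mrec (enumerate X)"
proof -
  have "enumerate X n = rec_nat (LEAST y. y \<in> X) (\<lambda>m r. LEAST y. y \<in> X \<and> r < y) n" for n
    by (induction n) (simp_all add: enumerate_0 enumerate_Suc'' assms(2))
  moreover have "mrec (\<lambda>n. rec_nat (LEAST y. y \<in> X) (\<lambda>m r. LEAST y. y \<in> X \<and> r < y) n)"
  proof (intro mrec_rec_nat mrec_basic)
    have "mrec (\<lambda>r. LEAST y. y \<in> X \<and> r < y)"
    proof (rule mrec_Least)
      show "dec (\<lambda>z. pi2 z \<in> X \<and> pi1 z < pi2 z)"
        by (intro mrec_basic dec_mem assms)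
      show "\<exists>y. y \<in> X \<and> x < y" for x
        using assms(2) by (meson infinite_nat_iff_unbounded)
    qed
    then show "mrec (\<lambda>z. LEAST y. y \<in> X \<and> pi2 (pi2 z) < y)"
      by (rule mrec_comp) (intro mrec_basic)
  qed
  ultimately show ?thesis by presburger
qed

text \<open>The coloring is pulled back along the increasing enumeration of \<open>X\<close>. The
  hypothesis on the ideal applies to the pullback, and the image of the resulting set lies inside
  \<open>X\<close>.\<close>

lemma RT_below:
  assumes X: "X \<in> \<M>" "infinite X" and \<phi>: "mrec \<phi>" "\<And>d. \<phi> d < k" and RT: "models_RT \<M> s l"
  shows "\<exists>Y\<in>\<M>. infinite Y \<and> Y \<subseteq> X \<and> card ((\<lambda>F. \<phi> (set_encode F)) ` [Y]\<^bsup>s\<^esup>) \<le> l"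
proof -
  define p where "p = enumerate X"
  have p: "mrec p" unfolding p_def by (rule mrec_enumerate[OF X])
  have sm: "strict_mono p" unfolding p_def by (rule strict_mono_enumerate[OF X(2)])
  then have inj: "inj_on p A" for A by (meson strict_mono_eq inj_onI)
  have pX: "p i \<in> X" for i unfolding p_def by (rule enumerate_in_set[OF X(2)])
  define h where "h F = \<phi> (set_encode (p ` F))" for F
  have "coloring_code s h \<in> \<M>"
  proof -
    have "set_encode (p ` set_decode d) = (\<Sum>i<d. if i \<in> set_decode d then 2 ^ p i else 0)" for d
    proof -
      have "set_encode (p ` set_decode d) = (\<Sum>i\<in>set_decode d. 2 ^ p i)"
        unfolding set_encode_def by (simp add: sum.reindex inj)
      also have "\<dots> = (\<Sum>i\<in>{i \<in> {..<d}. i \<in> set_decode d}. 2 ^ p i)"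
        using less_if_mem_set_decode by (intro sum.cong) auto
      also have "\<dots> = (\<Sum>i<d. if i \<in> set_decode d then 2 ^ p i else 0)"
        by (rule sum.inter_filter) simp
      finally show ?thesis .
    qed
    moreover have "mrec (\<lambda>d. \<Sum>i<d. if i \<in> set_decode d then 2 ^ p i else 0)"
      by (intro mrec_sum mrec_basic dec_set_decode mrec_comp[OF p])
    ultimately have "mrec (\<lambda>d. set_encode (p ` set_decode d))" by simp
    from mrec_comp[OF \<phi>(1) this] have m: "mrec (\<lambda>d. h (set_decode d))" unfolding h_def .
    have "dec (\<lambda>z. card (set_decode (pi1 z)) = s \<and> pi2 z = h (set_decode (pi1 z)))"
      by (intro mrec_basic mrec_card_set_decode mrec_comp[OF m])
    moreover have "(card (set_decode (pi1 z)) = s \<and> pi2 z = h (set_decode (pi1 z)))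
       \<longleftrightarrow> z \<in> coloring_code s h" for z
    proof
      assume z: "card (set_decode (pi1 z)) = s \<and> pi2 z = h (set_decode (pi1 z))"
      then have "z = prod_encode (set_encode (set_decode (pi1 z)), h (set_decode (pi1 z)))"
        by (simp only: set_decode_inverse conjunct2[OF z, symmetric] prod_encode_pi)
      then show "z \<in> coloring_code s h"
        unfolding coloring_code_def by (rule image_eqI) (use z in \<open>simp add: nsets_def\<close>)
    qed (auto simp: coloring_code_def nsets_def)
    ultimately show ?thesis by (simp add: dec_iff_mem)
  qed
  moreover have "h \<in> [UNIV]\<^bsup>s\<^esup> \<rightarrow> {..<k}" unfolding h_def using \<phi>(2) by auto
  ultimately obtain H where H: "H \<in> \<M>" "infinite H" "card (h ` [H]\<^bsup>s\<^esup>) \<le> l"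
    using RT unfolding models_RT_def by blast
  show ?thesis
  proof (intro bexI conjI)
    \<comment> \<open>A strictly increasing function satisfies \<open>i \<le> p i\<close>, so
      membership in the image is a bounded search.\<close>
    have "dec (\<lambda>y. \<exists>i\<le>y. i \<in> H \<and> p i = y)"
      by (intro mrec_basic dec_mem H mrec_comp[OF p])
    moreover have "(\<exists>i\<le>y. i \<in> H \<and> p i = y) \<longleftrightarrow> y \<in> p ` H" for y
      using strict_mono_imp_increasing[OF sm] by blast
    ultimately show "p ` H \<in> \<M>" by (simp add: dec_iff_mem)
    show "infinite (p ` H)" using H(2) inj by (simp add: finite_image_iff)
    show "p ` H \<subseteq> X" using pX by blast
    have "(\<lambda>F. \<phi> (set_encode F)) ` [p ` H]\<^bsup>s\<^esup> \<subseteq> h ` [H]\<^bsup>s\<^esup>"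
    proof
      fix v assume "v \<in> (\<lambda>F. \<phi> (set_encode F)) ` [p ` H]\<^bsup>s\<^esup>"
      then obtain F where F: "F \<subseteq> p ` H" "finite F" "card F = s" "v = \<phi> (set_encode F)"
        unfolding nsets_def by blast
      from F(1) obtain F' where F': "F' \<subseteq> H" "F = p ` F'" by (auto simp: subset_image_iff)
      then have "F' \<in> [H]\<^bsup>s\<^esup>" using F inj by (auto simp: nsets_def finite_image_iff card_image)
      then show "v \<in> h ` [H]\<^bsup>s\<^esup>" unfolding h_def using F(4) F'(2) by blast
    qed
    moreover have "finite (h ` [H]\<^bsup>s\<^esup>)"
      by (rule finite_subset[of _ "{..<k}"]) (use \<phi>(2) in \<open>auto simp: h_def\<close>)
    ultimately show "card ((\<lambda>F. \<phi> (set_encode F)) ` [p ` H]\<^bsup>s\<^esup>) \<le> l"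
      using H(3) card_mono le_trans by blast
  qed
qed

lemma countable_mrec:
  assumes "countable \<M>"
  shows "countable {f. mrec f}"
proof -
  have "{f. mrec f} \<subseteq> (\<lambda>(A, p). \<lambda>x. THE y. eval A p [x] y) ` (\<M> \<times> (UNIV :: prog set))"
  proof
    fix f assume "f \<in> {f. mrec f}"
    then obtain A p where A: "A \<in> \<M>" "\<And>x. eval A p [x] (f x)"
      unfolding mrec_def rec1_def by blast
    then have "(THE y. eval A p [x] y) = f x" for x
      using eval_deterministic by blast
    then have "f = (\<lambda>x. THE y. eval A p [x] y)" by simp
    then show "f \<in> (\<lambda>(A, p). \<lambda>x. THE y. eval A p [x] y) ` (\<M> \<times> UNIV)"
      using A(1) by force
  qed
  moreover have "countable (\<M> \<times> (UNIV :: prog set))" using assms by simp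
  ultimately show ?thesis by (meson countable_image countable_subset)
qed

text \<open>Only countably many functions are computable in the ideal, so one decreasing sequence of
  reservoirs meets all thinning tasks. Its range is a filter base.\<close>

lemma generic_filter:
  assumes cM: "countable \<M>" and RT: "\<And>s. s \<in> {1..n} \<Longrightarrow> models_RT \<M> s (l s)"
  obtains U where "U \<subseteq> \<M>" "U \<noteq> {}" "\<And>X. X \<in> U \<Longrightarrow> infinite X"
    "\<And>X Y. X \<in> U \<Longrightarrow> Y \<in> U \<Longrightarrow> \<exists>Z\<in>U. Z \<subseteq> X \<and> Z \<subseteq> Y"
    "\<And>b. \<exists>X\<in>U. \<forall>x\<in>X. b \<le> x"
    "\<And>\<phi> k s. mrec \<phi> \<Longrightarrow> (\<And>d. \<phi> d < k) \<Longrightarrow> s \<in> {1..n} \<Longrightarrow>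
      \<exists>X\<in>U. card ((\<lambda>F. \<phi> (set_encode F)) ` [X]\<^bsup>s\<^esup>) \<le> l s"
proof -
  \<comment> \<open>The dummy size 0 keeps the set of tasks nonempty even for \<open>n = 0\<close>;
    such a task demands no thinning.\<close>
  define Tasks where "Tasks = {(\<phi>, s). mrec \<phi> \<and> (\<exists>k. \<forall>d. \<phi> d < k) \<and> s \<in> insert 0 {1..n}}"
  have "Tasks \<subseteq> {f. mrec f} \<times> UNIV" unfolding Tasks_def by blast
  then have cT: "countable Tasks"
    using countable_mrec[OF cM] by (meson countable_SIGMA countable_subset countableI_type)
  have neT: "Tasks \<noteq> {}"
    unfolding Tasks_def using mrec_const[of 0] by fastforce
  define task where "task = from_nat_into Tasks"
  have task: "task i \<in> Tasks" for i unfolding task_def by (rule from_nat_into[OF neT])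
  define solves where "solves i X \<longleftrightarrow> (\<forall>x\<in>X. i \<le> x) \<and> (snd (task i) \<in> {1..n} \<longrightarrow>
      card ((\<lambda>F. fst (task i) (set_encode F)) ` [X]\<^bsup>snd (task i)\<^esup>) \<le> l (snd (task i)))" for i X
  have step: "\<exists>Y. (Y \<in> \<M> \<and> infinite Y) \<and> Y \<subseteq> X \<and> solves i Y" if X: "X \<in> \<M> \<and> infinite X" for X i
  proof -
    \<comment> \<open>Dropping the numbers below \<open>i\<close> at stage \<open>i\<close> also
      produces reservoirs beyond every bound.\<close>
    define X' where "X' = {x. x \<in> X \<and> i \<le> x}"
    have "X' \<in> \<M>"
      unfolding X'_def dec_iff_mem[symmetric] by (intro mrec_basic dec_mem) (use X in blast)
    moreover have "infinite X'"
    proof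
      assume "finite X'"
      then have "finite (X' \<union> {..<i})" by simp
      moreover have "X \<subseteq> X' \<union> {..<i}" unfolding X'_def by auto
      ultimately show False using X finite_subset by blast
    qed
    ultimately have X': "X' \<in> \<M>" "infinite X'" .
    show ?thesis
    proof (cases "snd (task i) \<in> {1..n}")
      case True
      obtain k where "mrec (fst (task i))" "\<And>d. fst (task i) d < k"
        using task[of i] unfolding Tasks_def by (auto simp: case_prod_beta)
      from RT_below[OF X' this RT[OF True]] show ?thesis
        unfolding solves_def X'_def by blast
    next
      case False
      moreover have "\<forall>x\<in>X'. i \<le> x" unfolding X'_def by blast
      ultimately have "solves i X'" unfolding solves_def by blast
      then show ?thesis using X' unfolding X'_def by blast
    qed
  qed
  have "UNIV \<in> \<M>" using dec_const[of True] unfolding dec_iff_mem by simp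
  then obtain X where X: "\<And>i. X i \<in> \<M> \<and> infinite (X i)" "\<And>i. X (Suc i) \<subseteq> X i \<and> solves i (X (Suc i))"
    using dependent_nat_choice[of "\<lambda>_ X. X \<in> \<M> \<and> infinite X" "\<lambda>i X Y. Y \<subseteq> X \<and> solves i Y"] step
    by (metis infinite_UNIV_nat)
  have anti: "X j \<subseteq> X i" if "i \<le> j" for i j
    by (rule lift_Suc_antimono_le[OF _ that, of X]) (rule conjunct1[OF X(2)])
  show ?thesis
  proof (rule that[of "range X"])
    show "\<exists>Z\<in>range X. Z \<subseteq> A \<and> Z \<subseteq> B" if "A \<in> range X" "B \<in> range X" for A B
    proof -
      from that obtain i j where "A = X i" "B = X j" by blast
      then show ?thesis using anti[of i "max i j"] anti[of j "max i j"] by auto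
    qed
    show "\<exists>A\<in>range X. \<forall>x\<in>A. b \<le> x" for b
      using X(2)[of b] unfolding solves_def by blast
  next
    fix \<phi> k s assume "mrec \<phi>" "\<And>d. \<phi> d < (k::nat)" "s \<in> {1..n}"
    then have "(\<phi>, s) \<in> Tasks" unfolding Tasks_def by blast
    then obtain i where "task i = (\<phi>, s)"
      unfolding task_def using from_nat_into_surj[OF cT] by blast
    then show "\<exists>A\<in>range X. card ((\<lambda>F. \<phi> (set_encode F)) ` [A]\<^bsup>s\<^esup>) \<le> l s"
      using X(2)[of i] \<open>s \<in> {1..n}\<close> unfolding solves_def by auto
  qed (use X in auto)
qed

end

section \<open>Constraints and small assignments\<close>

text \<open>
  A constraint \<open>(s, k, c)\<close> stands for a coloring \<open>c\<close> of the \<open>s\<close>-element sets with \<open>k\<close> colors;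
  an assignment \<open>J\<close> attaches to it the set of colors that \<open>c\<close> may take.
\<close>

type_synonym constraint = "nat \<times> nat \<times> (nat set \<Rightarrow> nat)"

definition sat :: "(constraint \<Rightarrow> nat set) \<Rightarrow> constraint set \<Rightarrow> nat set \<Rightarrow> bool" where
  "sat J K E \<longleftrightarrow> (\<forall>(s, k, c)\<in>K. c ` [E]\<^bsup>s\<^esup> \<subseteq> J (s, k, c))"

text \<open>The cut at \<open>k\<close> leaves finitely many choices for each constraint, as
  compactness requires.\<close>

definition color_sets :: "(nat \<Rightarrow> nat) \<Rightarrow> constraint \<Rightarrow> nat set set" where
  "color_sets l = (\<lambda>(s, k, c). {A. A \<subseteq> {..<k} \<and> card A \<le> l s})"

text \<open>The bound holds for all arguments, so it passes directly to the shifted colorings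
  \<open>\<lambda>E. f (D \<union> E)\<close>.\<close>

definition colorings :: "nat \<Rightarrow> constraint set" where
  "colorings n = {(s, k, c). s \<in> {1..n} \<and> (\<forall>A. c A < k)}"

text \<open>Every set of numbers is made to code a tuple of colorings: \<open>i\<close> selects the
  coloring, \<open>d\<close> is the index of the colored set, and the least marked \<open>q\<close>
  is the color. If nothing is marked below \<open>k\<close>, the default is \<open>k - 1\<close>.
  Quantifying over tuples of colorings thereby becomes quantifying over Cantor space.\<close>

definition decode_color :: "nat \<Rightarrow> nat \<Rightarrow> nat set \<Rightarrow> nat \<Rightarrow> nat" where
  "decode_color i k S d = (LEAST q. prod_encode (i, prod_encode (d, q)) \<in> S \<or> k \<le> Suc q)"

lemma decode_color_cong:
  assumes "\<And>q. q < k \<Longrightarrow> prod_encode (i, prod_encode (d, q)) \<in> S \<longleftrightarrow> prod_encode (i, prod_encode (d, q)) \<in> S'"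
  shows "decode_color i k S d = decode_color i k S' d"
proof -
  have "(prod_encode (i, prod_encode (d, q)) \<in> S \<or> k \<le> Suc q)
      \<longleftrightarrow> (prod_encode (i, prod_encode (d, q)) \<in> S' \<or> k \<le> Suc q)" for q
    using assms[of q] by (cases "q < k") auto
  then show ?thesis unfolding decode_color_def by presburger
qed

lemma decode_color_less: "0 < k \<Longrightarrow> decode_color i k S d < k"
proof -
  assume "0 < k"
  have "decode_color i k S d \<le> k - 1"
    unfolding decode_color_def by (rule Least_le) auto
  then show ?thesis using \<open>0 < k\<close> by linarith
qed

lemma decode_color_eq:
  assumes "\<And>q. q < k \<Longrightarrow> prod_encode (i, prod_encode (d, q)) \<in> S \<longleftrightarrow> q = c" "c < k"
  shows "decode_color i k S d = c"
  unfolding decode_color_def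
proof (rule Least_equality)
  fix q assume q: "prod_encode (i, prod_encode (d, q)) \<in> S \<or> k \<le> Suc q"
  show "c \<le> q"
  proof (rule ccontr)
    assume "\<not> c \<le> q"
    then have "q < k" "q \<noteq> c" "\<not> k \<le> Suc q" using assms(2) by auto
    then show False using q assms(1)[of q] by blast
  qed
qed (use assms in blast)

locale generic_ideal = scott +
  fixes U :: "nat set set" and n :: nat and l :: "nat \<Rightarrow> nat" and B :: "nat set"
  assumes U_sub: "U \<subseteq> \<M>" and U_nonempty: "U \<noteq> {}"
    and U_infinite: "\<And>X. X \<in> U \<Longrightarrow> infinite X"
    and U_directed: "\<And>X Y. X \<in> U \<Longrightarrow> Y \<in> U \<Longrightarrow> \<exists>Z\<in>U. Z \<subseteq> X \<and> Z \<subseteq> Y"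
    and U_tail: "\<And>b. \<exists>X\<in>U. \<forall>x\<in>X. b \<le> x"
    and U_thin: "\<And>\<phi> k s. mrec \<phi> \<Longrightarrow> (\<And>d. \<phi> d < k) \<Longrightarrow> s \<in> {1..n} \<Longrightarrow>
      \<exists>X\<in>U. card ((\<lambda>F. \<phi> (set_encode F)) ` [X]\<^bsup>s\<^esup>) \<le> l s"
    and B: "B \<notin> \<M>"
begin

lemma U_directed_finite:
  assumes "finite I" "\<And>i. i \<in> I \<Longrightarrow> X i \<in> U" "Y \<in> U"
  shows "\<exists>Z\<in>U. Z \<subseteq> Y \<and> (\<forall>i\<in>I. Z \<subseteq> X i)"
  using assms
proof (induction I rule: finite_induct)
  case (insert i I)
  then obtain Z where Z: "Z \<in> U" "Z \<subseteq> Y" "\<forall>i\<in>I. Z \<subseteq> X i" by blast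
  moreover obtain Z' where "Z' \<in> U" "Z' \<subseteq> Z" "Z' \<subseteq> X i"
    using U_directed[OF Z(1)] insert.prems by blast
  ultimately show ?case by (intro bexI[of _ Z']) auto
qed blast

text \<open>
  A requirement is a \<open>\<Sigma>\<^sub>1\<close> functional: \<open>R x v E\<close> says that the finite set \<open>E\<close> produces
  the value \<open>v\<close> at \<open>x\<close>.
\<close>

definition req :: "(nat \<Rightarrow> nat \<Rightarrow> nat set \<Rightarrow> bool) \<Rightarrow> bool" where
  "req R \<longleftrightarrow> sig (\<lambda>z. R (pi1 z) (pi1 (pi2 z)) (set_decode (pi2 (pi2 z))))"

text \<open>
  The requirement \<open>R\<close> is stuck on the reservoir \<open>X\<close> if neither a wrong value can be forced by an
  admissible block nor the right value be avoided by shrinking the reservoir.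
\<close>

definition stuck ::
  "nat set \<Rightarrow> (nat \<Rightarrow> nat \<Rightarrow> nat set \<Rightarrow> bool) \<Rightarrow> (constraint \<Rightarrow> nat set) \<Rightarrow> constraint set \<Rightarrow> bool" where
  "stuck X R J K \<longleftrightarrow>
     (\<forall>x E. E \<noteq> {} \<and> finite E \<and> E \<subseteq> X \<and> sat J K E \<longrightarrow> \<not> R x (of_bool (x \<notin> B)) E)
     \<and> (\<forall>x. \<forall>Z\<in>U. \<exists>E. E \<noteq> {} \<and> finite E \<and> E \<subseteq> Z \<and> R x (of_bool (x \<in> B)) E)"

text \<open>The obstruction to the construction: if it is absent, every requirement can be met
  inside every reservoir of the filter.\<close>

definition small :: "(constraint \<Rightarrow> nat set) \<Rightarrow> constraint set \<Rightarrow> bool" where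
  "small J K \<longleftrightarrow> (\<exists>X\<in>U. \<exists>R. req R \<and> stuck X R J K)"

text \<open>The \<open>\<Sigma>\<^sub>1\<close> question is the predicate \<open>succ\<close>, posed
  for pairs \<open>(x, v)\<close>. Fact \<open>A\<close> refutes it for the wrong value and
  \<open>Bx\<close> confirms it for the right one, so \<open>B\<close> and its complement are both
  semidecidable in the ideal.\<close>

lemma ex_not_small:
  assumes K: "finite K" "K \<subseteq> colorings n"
  shows "\<exists>J\<in>Pi\<^sub>E K (color_sets l). \<not> small J K"
proof (rule ccontr)
  assume "\<not> ?thesis"
  then have sm: "\<And>J. J \<in> Pi\<^sub>E K (color_sets l) \<Longrightarrow> small J K" by blast
  define \<J> where "\<J> = Pi\<^sub>E K (color_sets l)"
  have "finite (color_sets l \<kappa>)" for \<kappa>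
    unfolding color_sets_def by (cases \<kappa>) (auto intro: finite_subset[of _ "Pow {..<_}"])
  then have fin: "finite \<J>" unfolding \<J>_def using K(1) by (intro finite_PiE) auto
  from bchoice[OF ballI[OF sm[folded \<J>_def, unfolded small_def Bex_def]]]
  obtain X0 where X0': "\<forall>J\<in>\<J>. X0 J \<in> U \<and> (\<exists>R. req R \<and> stuck (X0 J) R J K)" ..
  from X0' have X0: "\<And>J. J \<in> \<J> \<Longrightarrow> X0 J \<in> U" by blast
  from X0' have "\<forall>J\<in>\<J>. \<exists>R. req R \<and> stuck (X0 J) R J K" by blast
  from bchoice[OF this] obtain R where R': "\<forall>J\<in>\<J>. req (R J) \<and> stuck (X0 J) (R J) J K" ..
  then have R: "\<And>J. J \<in> \<J> \<Longrightarrow> req (R J)" by blast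
  have no_a: "\<not> R J x (of_bool (x \<notin> B)) E"
    if "J \<in> \<J>" "E \<noteq> {}" "finite E" "E \<subseteq> X0 J" "sat J K E" for J x E
    using bspec[OF R' that(1)] that(2-) unfolding stuck_def by blast
  have no_b: "\<exists>E. E \<noteq> {} \<and> finite E \<and> E \<subseteq> Z \<and> R J x (of_bool (x \<in> B)) E"
    if "J \<in> \<J>" "Z \<in> U" for J x Z
    using conjunct2[OF conjunct2[OF bspec[OF R' that(1)], unfolded stuck_def]] that(2) by blast
  obtain Y where "Y \<in> U" using U_nonempty by blast
  from U_directed_finite[OF fin, of X0, OF X0 this] obtain X where X: "X \<in> U" "\<And>J. J \<in> \<J> \<Longrightarrow> X \<subseteq> X0 J" by blast
  from bchoice[OF ballI[OF R[unfolded req_def sig_def]]]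
  obtain Q where Q0: "\<forall>J\<in>\<J>. dec (\<lambda>z. Q J (pi1 z) (pi2 z)) \<and>
      (\<lambda>z. R J (pi1 z) (pi1 (pi2 z)) (set_decode (pi2 (pi2 z)))) = (\<lambda>z. \<exists>w. Q J z w)" ..
  have RQ: "R J x v (set_decode e) \<longleftrightarrow> (\<exists>w. Q J (prod_encode (x, prod_encode (v, e))) w)" if "J \<in> \<J>" for J x v e
    using fun_cong[OF conjunct2[OF bspec[OF Q0 that]], of "prod_encode (x, prod_encode (v, e))"] by simp
  have Qdec: "dec (\<lambda>z. Q J (f z) (g z))" if "J \<in> \<J>" "mrec f" "mrec g" for J f g
    using dec_subst[OF conjunct1[OF bspec[OF Q0 that(1)]] mrec_pair[OF that(2,3)]] by simp
  \<comment> \<open>Distinct numbers for the constraints in \<open>K\<close> let one set of numbers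
    code a coloring for each of them.\<close>
  obtain idx :: "constraint \<Rightarrow> nat" where idx: "inj_on idx K"
    using finite_imp_inj_to_nat_seg[OF K(1)] by blast
  let ?s = "\<lambda>\<kappa> :: constraint. fst \<kappa>" and ?k = "\<lambda>\<kappa> :: constraint. fst (snd \<kappa>)"
    and ?c = "\<lambda>\<kappa> :: constraint. snd (snd \<kappa>)"
  define pos where "pos \<kappa> d q = prod_encode (idx \<kappa>, prod_encode (d, q))" for \<kappa> d q
  define col where "col \<kappa> S d = decode_color (idx \<kappa>) (?k \<kappa>) S d" for \<kappa> S d
  \<comment> \<open>All bits that determine the colors of subsets of the block lie below
    \<open>m\<close>, so the first \<open>m\<close> bits suffice to check \<open>V\<close>.\<close>
  define posb where "posb e m \<longleftrightarrow> (\<forall>\<kappa>\<in>K. \<forall>d\<le>e. \<forall>q<?k \<kappa>. pos \<kappa> d q < m)" for e m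
  \<comment> \<open>This is \<open>sat\<close> for the decoded colorings. A subset of a finite set
    never has a larger index, so the bound \<open>d \<le> e\<close> loses none.\<close>
  define V where "V J S e \<longleftrightarrow> (\<forall>\<kappa>\<in>K. \<forall>d\<le>e. set_decode d \<subseteq> set_decode e \<and> card (set_decode d) = ?s \<kappa>
      \<longrightarrow> col \<kappa> S d \<in> J \<kappa>)" for J S e
  define inX where "inX e \<longleftrightarrow> (\<forall>i<e. i \<in> set_decode e \<longrightarrow> i \<in> X)" for e
  define core where "core y m S J e w \<longleftrightarrow> e \<noteq> 0 \<and> inX e \<and> posb e m \<and> V J S e
      \<and> Q J (prod_encode (pi1 y, prod_encode (pi2 y, e))) w" for y m S J e w
  define W where "W y m t \<longleftrightarrow> (\<exists>J\<in>\<J>. \<exists>e\<le>m. \<exists>w\<le>m. core y m (set_decode t) J e w)" for y m t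
  have V_cong: "V J S e \<longleftrightarrow> V J S' e"
    if "posb e m" "\<forall>i<m. i \<in> S \<longleftrightarrow> i \<in> S'" for J S S' e m
  proof -
    have "col \<kappa> S d = col \<kappa> S' d" if "\<kappa> \<in> K" "d \<le> e" for \<kappa> d
      unfolding col_def
      by (rule decode_color_cong)
         (use \<open>posb e m\<close> \<open>\<forall>i<m. i \<in> S \<longleftrightarrow> i \<in> S'\<close> that in \<open>auto simp: posb_def pos_def\<close>)
    then show ?thesis unfolding V_def by auto
  qed
  have mono: "W y m' t'"
    if W: "W y m t" and mm': "m \<le> m'" and agree: "\<forall>i<m. i \<in> set_decode t \<longleftrightarrow> i \<in> set_decode t'" for y m t m' t'
  proof -
    obtain J e w where JEw: "J \<in> \<J>" "e \<le> m" "w \<le> m" "core y m (set_decode t) J e w"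
      using W unfolding W_def by blast
    have pb: "posb e m" using JEw(4) unfolding core_def by blast
    then have "posb e m'" using mm' unfolding posb_def by (meson less_le_trans)
    then have "core y m' (set_decode t') J e w"
      using JEw(4) V_cong[OF pb agree] unfolding core_def by blast
    moreover have "e \<le> m'" "w \<le> m'" using JEw(2,3) mm' by auto
    ultimately show ?thesis unfolding W_def using JEw(1) by blast
  qed
  have Wdec: "dec (\<lambda>z. W (f z) (g z) (h z))" if f: "mrec f" and g: "mrec g" and h: "mrec h" for f g h
  proof -
    have c: "mrec (\<lambda>z. f (p z))" "mrec (\<lambda>z. g (p z))" "mrec (\<lambda>z. h (p z))" if "mrec p" for p
      using f g h that by (auto intro: mrec_comp)
    have col': "mrec (\<lambda>z. col \<kappa> (set_decode (p z)) (p' z))" if "mrec p" "mrec p'" for \<kappa> p p'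
      unfolding col_def decode_color_def
    proof (rule mrec_Least)
      have "mrec (\<lambda>z. p (pi1 z))" "mrec (\<lambda>z. p' (pi1 z))" by (intro mrec_comp[OF that(1)] mrec_comp[OF that(2)] mrec_basic)+
      then show "dec (\<lambda>z. prod_encode (idx \<kappa>, prod_encode (p' (pi1 z), pi2 z)) \<in> set_decode (p (pi1 z)) \<or> ?k \<kappa> \<le> Suc (pi2 z))"
        by (intro mrec_basic dec_set_decode)
      show "\<exists>y. prod_encode (idx \<kappa>, prod_encode (p' x, y)) \<in> set_decode (p x) \<or> ?k \<kappa> \<le> Suc y" for x
        by (intro exI[of _ "?k \<kappa>"]) simp
    qed
    have fJ: "finite (J \<kappa>)" if "J \<in> \<J>" "\<kappa> \<in> K" for J \<kappa>
    proof -
      have "J \<kappa> \<in> color_sets l \<kappa>" using that unfolding \<J>_def by blast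
      then show ?thesis unfolding color_sets_def by (auto simp: case_prod_beta intro: finite_subset)
    qed
    show ?thesis
      unfolding W_def core_def inX_def posb_def V_def pos_def
      by (intro dec_finite_disj[OF fin] dec_finite_conj[OF K(1)] mrec_basic dec_set_decode
          dec_mem[OF subsetD[OF U_sub X(1)]] dec_set_decode_subset mrec_card_set_decode
          dec_mem_finite[OF fJ] col' Qdec c)
  qed
  \<comment> \<open>All strings of some length \<open>m\<close> are covered: whatever colorings a
    set codes, some assignment admits a block with the given value. Only the quantifier over
    \<open>m\<close> is unbounded.\<close>
  define succ where "succ y \<longleftrightarrow> (\<exists>m. \<forall>t<2 ^ m. W y m t)" for y
  have sig_succ: "sig (\<lambda>x. succ (prod_encode (x, v)))" for v
    unfolding succ_def by (intro sigI mrec_basic Wdec)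
  have A: "\<not> succ (prod_encode (x, of_bool (x \<notin> B)))" for x
  proof
    let ?v = "of_bool (x \<notin> B) :: nat"
    assume "succ (prod_encode (x, ?v))"
    then obtain m where m: "\<And>t. t < 2 ^ m \<Longrightarrow> W (prod_encode (x, ?v)) m t" unfolding succ_def by blast
    \<comment> \<open>The graph of the given colorings, cut off at \<open>m\<close>. The covering
      applied to it yields a block that satisfies the actual constraints.\<close>
    define S where "S = {p. p < m \<and> (\<exists>\<kappa>\<in>K. \<exists>d. p = pos \<kappa> d (?c \<kappa> (set_decode d)))}"
    have S: "S \<subseteq> {..<m}" unfolding S_def by auto
    then have "finite S" using finite_subset by blast
    then have Sd: "set_decode (set_encode S) = S" by simp
    from m[OF set_encode_less[OF S]] obtain J e w where "J \<in> \<J>" "core (prod_encode (x, ?v)) m S J e w"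
      unfolding W_def Sd by blast
    then have JEw: "J \<in> \<J>" "e \<noteq> 0" "inX e" "posb e m" "V J S e" "Q J (prod_encode (x, prod_encode (?v, e))) w"
      unfolding core_def by simp_all
    have "R J x ?v (set_decode e)" using JEw(1,6) RQ by blast
    moreover have "set_decode e \<noteq> {}"
      using JEw(2) by (metis set_decode_inverse set_encode_empty)
    moreover have "set_decode e \<subseteq> X0 J"
      using JEw(3) X(2)[OF JEw(1)] less_if_mem_set_decode unfolding inX_def by blast
    moreover have "sat J K (set_decode e)"
      unfolding sat_def
    proof (clarify)
      fix s k c D assume \<kappa>: "(s, k, c) \<in> K" and D: "D \<in> [set_decode e]\<^bsup>s\<^esup>"
      define d where "d = set_encode D"
      have d: "set_decode d = D" "d \<le> e"
        using D set_encode_mono[of "set_decode e" D] unfolding d_def nsets_def by auto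
      have "c D < k" using K(2) \<kappa> unfolding colorings_def by blast
      have "col (s, k, c) S d = c D"
        unfolding col_def fst_conv snd_conv
      proof (rule decode_color_eq)
        fix q assume "q < k"
        then have "pos (s, k, c) d q < m" using JEw(4) \<kappa> d(2) unfolding posb_def by force
        then show "prod_encode (idx (s, k, c), prod_encode (d, q)) \<in> S \<longleftrightarrow> q = c D"
          unfolding S_def pos_def using \<kappa> d(1) inj_onD[OF idx, of "(s, k, c)"]
          by (auto simp: prod_encode_eq)
      qed fact
      moreover have "col (s, k, c) S d \<in> J (s, k, c)"
        using JEw(5) \<kappa> d D unfolding V_def nsets_def by force
      ultimately show "c D \<in> J (s, k, c)" by simp
    qed
    ultimately show False using no_a[OF JEw(1)] by (meson finite_set_decode)
  qed
  have Bx: "succ (prod_encode (x, of_bool (x \<in> B)))" for x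
  proof (rule ccontr)
    let ?v = "of_bool (x \<in> B) :: nat"
    assume "\<not> succ (prod_encode (x, ?v))"
    \<comment> \<open>If the covering fails, the ideal contains a set \<open>P\<close> that codes
      colorings for which no assignment admits a block with the right value.\<close>
    moreover have "(\<exists>m. \<forall>t<2 ^ m. W (prod_encode (x, ?v)) m t) \<or>
        (\<exists>P\<in>\<M>. \<forall>m t. (\<forall>i<m. i \<in> set_decode t \<longleftrightarrow> i \<in> P) \<longrightarrow> \<not> W (prod_encode (x, ?v)) m t)"
      by (rule scott_open) (intro Wdec mrec_basic, rule mono)
    ultimately obtain P where P: "P \<in> \<M>"
      "\<And>m t. (\<forall>i<m. i \<in> set_decode t \<longleftrightarrow> i \<in> P) \<Longrightarrow> \<not> W (prod_encode (x, ?v)) m t"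
      unfolding succ_def by blast
    have "\<exists>Y\<in>U. card ((\<lambda>F. col \<kappa> P (set_encode F)) ` [Y]\<^bsup>?s \<kappa>\<^esup>) \<le> l (?s \<kappa>)" if "\<kappa> \<in> K" for \<kappa>
    proof (rule U_thin[of "col \<kappa> P" "?k \<kappa>"])
      show "mrec (col \<kappa> P)"
        unfolding col_def decode_color_def
      proof (rule mrec_Least)
        show "dec (\<lambda>z. prod_encode (idx \<kappa>, prod_encode (pi1 z, pi2 z)) \<in> P \<or> ?k \<kappa> \<le> Suc (pi2 z))"
          by (intro mrec_basic dec_mem[OF P(1)])
        show "\<exists>y. prod_encode (idx \<kappa>, prod_encode (x, y)) \<in> P \<or> ?k \<kappa> \<le> Suc y" for x
          by (intro exI[of _ "?k \<kappa>"]) simp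
      qed
      have "\<kappa> \<in> colorings n" using that K(2) by blast
      then have "\<forall>A. ?c \<kappa> A < ?k \<kappa>" "?s \<kappa> \<in> {1..n}" unfolding colorings_def by (auto simp: case_prod_beta)
      then show "?s \<kappa> \<in> {1..n}" "col \<kappa> P d < ?k \<kappa>" for d
        unfolding col_def by (auto intro!: decode_color_less intro: le_less_trans[OF le0])
    qed
    then obtain Y where Y: "\<And>\<kappa>. \<kappa> \<in> K \<Longrightarrow> Y \<kappa> \<in> U \<and> card ((\<lambda>F. col \<kappa> P (set_encode F)) ` [Y \<kappa>]\<^bsup>?s \<kappa>\<^esup>) \<le> l (?s \<kappa>)"
      by metis
    from U_directed_finite[OF K(1) _ X(1), of Y] Y obtain Z where
      Z: "Z \<in> U" "Z \<subseteq> X" "\<And>\<kappa>. \<kappa> \<in> K \<Longrightarrow> Z \<subseteq> Y \<kappa>" by blast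
    \<comment> \<open>The colors that the colorings coded by \<open>P\<close> take on the thinned
      reservoir \<open>Z\<close> form an assignment. As it is stuck, the right value occurs on some
      block inside \<open>Z\<close>, and that block is admissible by the choice of
      \<open>J\<close>.\<close>
    define J where "J = restrict (\<lambda>\<kappa>. (\<lambda>F. col \<kappa> P (set_encode F)) ` [Z]\<^bsup>?s \<kappa>\<^esup>) K"
    have J: "J \<in> \<J>"
      unfolding \<J>_def J_def
    proof (rule restrict_PiE_iff[THEN iffD2], rule ballI)
      fix \<kappa> assume \<kappa>: "\<kappa> \<in> K"
      have "\<kappa> \<in> colorings n" using \<kappa> K(2) by blast
      then have "\<forall>A. ?c \<kappa> A < ?k \<kappa>" unfolding colorings_def by (auto simp: case_prod_beta)
      then have lt: "col \<kappa> P d < ?k \<kappa>" for d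
        unfolding col_def by (auto intro!: decode_color_less intro: le_less_trans[OF le0])
      let ?I = "\<lambda>Z. (\<lambda>F. col \<kappa> P (set_encode F)) ` [Z]\<^bsup>?s \<kappa>\<^esup>"
      have "?I Z \<subseteq> ?I (Y \<kappa>)" using Z(3)[OF \<kappa>] by (intro image_mono nsets_mono)
      moreover have "finite (?I (Y \<kappa>))" by (rule finite_subset[of _ "{..<?k \<kappa>}"]) (use lt in auto)
      ultimately have "card (?I Z) \<le> l (?s \<kappa>)" using Y[OF \<kappa>] card_mono le_trans by blast
      moreover have "?I Z \<subseteq> {..<?k \<kappa>}" using lt by auto
      ultimately show "?I Z \<in> color_sets l \<kappa>" unfolding color_sets_def by (simp add: case_prod_beta)
    qed
    from no_b[OF J Z(1)] obtain E where E: "E \<noteq> {}" "finite E" "E \<subseteq> Z" "R J x ?v E" by blast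
    define e where "e = set_encode E"
    have e: "set_decode e = E" unfolding e_def using E(2) by simp
    then obtain w where w: "Q J (prod_encode (x, prod_encode (?v, e))) w"
      using RQ[OF J] E(4) by blast
    have "finite (\<Union>\<kappa>\<in>K. \<Union>d\<in>{..e}. (\<lambda>q. pos \<kappa> d q) ` {..<?k \<kappa>})" using K(1) by blast
    then obtain b where b: "(\<Union>\<kappa>\<in>K. \<Union>d\<in>{..e}. (\<lambda>q. pos \<kappa> d q) ` {..<?k \<kappa>}) \<subseteq> {..<b}"
      unfolding finite_nat_iff_bounded ..
    \<comment> \<open>Large enough for the block, its witness and all consulted bits of
      \<open>P\<close>, so that \<open>W\<close> covers an initial segment of
      \<open>P\<close>.\<close>
    define m where "m = b + e + w"
    define t where "t = set_encode {i. i < m \<and> i \<in> P}"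
    have t: "\<forall>i<m. i \<in> set_decode t \<longleftrightarrow> i \<in> P" unfolding t_def by simp
    have pb: "posb e m"
      unfolding posb_def
    proof (intro ballI allI impI)
      fix \<kappa> d q assume "\<kappa> \<in> K" "d \<le> e" "q < ?k \<kappa>"
      then have "pos \<kappa> d q < b" using b by blast
      then show "pos \<kappa> d q < m" unfolding m_def by simp
    qed
    have "V J P e"
      unfolding V_def
    proof (intro ballI allI impI)
      fix \<kappa> d assume \<kappa>: "\<kappa> \<in> K" and d: "d \<le> e" "set_decode d \<subseteq> set_decode e \<and> card (set_decode d) = ?s \<kappa>"
      have "set_decode d \<in> [Z]\<^bsup>?s \<kappa>\<^esup>" using d E(3) by (auto simp: nsets_def e)
      then have "col \<kappa> P (set_encode (set_decode d)) \<in> J \<kappa>"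
        unfolding J_def restrict_apply'[OF \<kappa>] by (rule imageI)
      then show "col \<kappa> P d \<in> J \<kappa>" by simp
    qed
    then have "V J (set_decode t) e" using V_cong[OF pb t] by blast
    moreover have "e \<noteq> 0" using e E(1) by auto
    moreover have "inX e" unfolding inX_def using e E(3) Z(2) by blast
    ultimately have "core (prod_encode (x, ?v)) m (set_decode t) J e w"
      unfolding core_def using pb w by simp
    moreover have "e \<le> m" "w \<le> m" unfolding m_def by auto
    ultimately have "W (prod_encode (x, ?v)) m t"
      unfolding W_def using J by blast
    then show False using P(2)[OF t] by blast
  qed
  have eqB: "succ (prod_encode (x, 1)) \<longleftrightarrow> x \<in> B" "succ (prod_encode (x, 0)) \<longleftrightarrow> x \<notin> B" for x
    using A[of x] Bx[of x] by (cases "x \<in> B"; simp)+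
  have "dec (\<lambda>x. x \<in> B)"
    using dec_if_sig[of "\<lambda>x. x \<in> B"] sig_succ[of 1] sig_succ[of 0] unfolding eqB by blast
  then show False using B by (simp add: dec_iff_mem)
qed

end

section \<open>Limit colorings and the counting argument\<close>

text \<open>A product of finite discrete spaces is compact. The assignments that are not bad for a
  finite \<open>K\<close> form a closed set, since badness depends on finitely many coordinates, and
  monotonicity gives the finite intersection property.\<close>

lemma compactness_choice:
  fixes Ch :: "'i \<Rightarrow> 'a set" and bad :: "('i \<Rightarrow> 'a) \<Rightarrow> 'i set \<Rightarrow> bool"
  assumes fin: "\<And>i. finite (Ch i)"
    and ex: "\<And>K. finite K \<Longrightarrow> \<exists>J\<in>Pi UNIV Ch. \<not> bad J K"
    and local: "\<And>K J J'. (\<And>i. i \<in> K \<Longrightarrow> J i = J' i) \<Longrightarrow> bad J K \<Longrightarrow> bad J' K"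
    and mono: "\<And>K K' J. K \<subseteq> K' \<Longrightarrow> bad J K \<Longrightarrow> bad J K'"
  obtains J where "J \<in> Pi UNIV Ch" "\<And>K. finite K \<Longrightarrow> \<not> bad J K"
proof -
  define T where "T = product_topology (\<lambda>i. discrete_topology (Ch i)) UNIV"
  have top: "topspace T = Pi UNIV Ch" unfolding T_def by (simp add: PiE_UNIV_domain)
  have "compact_space T"
    unfolding T_def by (simp add: compact_space_product_topology compact_space_discrete_topology fin)
  define C where "C K = {J \<in> Pi UNIV Ch. \<not> bad J K}" for K
  have closed: "closedin T (C K)" if K: "finite K" for K
  proof -
    have "openin T {J' \<in> Pi UNIV Ch. \<forall>i\<in>K. J' i = J i}" if J: "J \<in> Pi UNIV Ch" for J
    proof -
      let ?S = "\<lambda>i. if i \<in> K then {J i} else Ch i"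
      have "{J' \<in> Pi UNIV Ch. \<forall>i\<in>K. J' i = J i} = Pi\<^sub>E UNIV ?S"
        using J by (auto simp: PiE_UNIV_domain Pi_iff split: if_splits)
      moreover have "openin T (Pi\<^sub>E UNIV ?S)"
        unfolding T_def
      proof (subst openin_PiE_gen, intro disjI2 conjI ballI)
        show "finite {i \<in> UNIV. ?S i \<noteq> topspace (discrete_topology (Ch i))}"
          by (rule finite_subset[OF _ K]) auto
        show "openin (discrete_topology (Ch i)) (?S i)" for i
          using J by (auto simp: Pi_iff)
      qed
      ultimately show ?thesis by simp
    qed
    then have "openin T (\<Union>J\<in>{J \<in> Pi UNIV Ch. bad J K}. {J' \<in> Pi UNIV Ch. \<forall>i\<in>K. J' i = J i})"
      by (intro openin_Union) blast
    also have "(\<Union>J\<in>{J \<in> Pi UNIV Ch. bad J K}. {J' \<in> Pi UNIV Ch. \<forall>i\<in>K. J' i = J i}) = topspace T - C K"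
      unfolding top C_def using local[of K] by (auto; metis)
    finally show ?thesis unfolding closedin_def top C_def by auto
  qed
  have "\<Inter>(C ` {K. finite K}) \<noteq> {}"
  proof (rule \<open>compact_space T\<close>[unfolded compact_space_fip, rule_format], intro conjI allI impI ballI)
    show "closedin T A" if "A \<in> C ` {K. finite K}" for A using that closed by blast
  next
    fix \<F> assume F: "finite \<F> \<and> \<F> \<subseteq> C ` {K. finite K}"
    then obtain KK where KK: "finite KK" "KK \<subseteq> {K. finite K}" "\<F> = C ` KK"
      by (meson finite_subset_image)
    then have "finite (\<Union>KK)" by blast
    from ex[OF this] obtain J where J: "J \<in> Pi UNIV Ch" "\<not> bad J (\<Union>KK)" by blast
    have "J \<in> C K" if "K \<in> KK" for K
      unfolding C_def using J mono[of K "\<Union>KK" J] that by blast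
    then show "\<Inter>\<F> \<noteq> {}" using KK(3) by blast
  qed
  then obtain J where J: "\<And>K. finite K \<Longrightarrow> J \<in> C K" by blast
  show ?thesis
    by (rule that[of J]) (use J[of "{}"] J in \<open>auto simp: C_def\<close>)
qed

text \<open>
  If \<open>f\<close> colors \<open>n\<close>-element sets, \<open>limit_coloring J n k f t\<close> colors a \<open>t\<close>-element set \<open>D\<close> with
  (a code of) the set of colors prescribed for \<open>f (D \<union> E)\<close> when \<open>E\<close> is taken from a later block.
\<close>

definition limit_coloring ::
  "(constraint \<Rightarrow> nat set) \<Rightarrow> nat \<Rightarrow> nat \<Rightarrow> (nat set \<Rightarrow> nat) \<Rightarrow> nat \<Rightarrow> nat set \<Rightarrow> nat" where
  "limit_coloring J n k f t D = set_encode (J (n - t, k, \<lambda>E. f (D \<union> E)))"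

text \<open>The elements chosen so far form \<open>F\<close>, and the next block has to obey these
  constraints. The case \<open>D = {}\<close> restrains \<open>f\<close> on the block itself. The
  recursive calls treat the limit colorings, which have \<open>2 ^ k\<close> colors because they
  code sets of colors below \<open>k\<close>.\<close>

fun block_constraints ::
  "(constraint \<Rightarrow> nat set) \<Rightarrow> nat \<Rightarrow> nat \<Rightarrow> (nat set \<Rightarrow> nat) \<Rightarrow> nat set \<Rightarrow> constraint set" where
  "block_constraints J n k f F =
     (\<lambda>D. (n - card D, k, \<lambda>E. f (D \<union> E))) ` {D. D \<subseteq> F \<and> card D < n}
     \<union> (\<Union>t\<in>{1..<n}. block_constraints J t (2 ^ k) (limit_coloring J n k f t) F)"

declare block_constraints.simps[simp del]

fun block_bound :: "(nat \<Rightarrow> nat) \<Rightarrow> nat \<Rightarrow> nat" where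
  "block_bound l n = l n + (\<Sum>t\<in>{1..<n}. l (n - t) * block_bound l t)"

declare block_bound.simps[simp del]

section \<open>Counting the colors on a union of blocks\<close>

lemma limit_coloring_less:
  assumes "J \<in> Pi UNIV (color_sets l)"
  shows "limit_coloring J n k f t D < 2 ^ k"
  unfolding limit_coloring_def
  by (rule set_encode_less) (use assms in \<open>force simp: Pi_iff color_sets_def\<close>)

text \<open>\<open>N\<close> stays fixed while the induction lowers \<open>n\<close>, so the
  constraints of all recursive calls land in the same set of colorings.\<close>

lemma block_constraints_colorings:
  assumes J: "J \<in> Pi UNIV (color_sets l)" and F: "finite F"
  shows "n \<le> N \<Longrightarrow> (\<And>A. f A < k) \<Longrightarrow>
    finite (block_constraints J n k f F) \<and> block_constraints J n k f F \<subseteq> colorings N"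
proof (induction n arbitrary: k f rule: less_induct)
  case (less n)
  have "finite {D. D \<subseteq> F \<and> card D < n}"
    by (rule finite_subset[of _ "Pow F"]) (use F in auto)
  moreover have "(\<lambda>D. (n - card D, k, \<lambda>E. f (D \<union> E))) ` {D. D \<subseteq> F \<and> card D < n} \<subseteq> colorings N"
    using less.prems by (auto simp: colorings_def)
  moreover have "finite (block_constraints J t (2 ^ k) (limit_coloring J n k f t) F)
      \<and> block_constraints J t (2 ^ k) (limit_coloring J n k f t) F \<subseteq> colorings N" if "t \<in> {1..<n}" for t
    using less.IH[of t "limit_coloring J n k f t" "2 ^ k"] that less.prems(1) limit_coloring_less[OF J] by auto
  ultimately show ?case
    unfolding block_constraints.simps[of J n k f F] by (intro conjI finite_UnI Un_least UN_least) blast+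
qed

lemma nsets_Union_blocks:
  fixes E :: "nat \<Rightarrow> 'a set"
  assumes A: "A \<in> [\<Union>i. E i]\<^bsup>n\<^esup>" "n \<ge> 1"
  obtains j D E' where "A = D \<union> E'" "D \<subseteq> (\<Union>i<j. E i)" "card D < n" "finite D" "E' \<in> [E j]\<^bsup>(n - card D)\<^esup>"
proof -
  have fin: "finite A" and sub: "A \<subseteq> (\<Union>i. E i)" and card: "card A = n"
    using A(1) unfolding nsets_def by auto
  have "\<forall>a\<in>A. \<exists>i. a \<in> E i" using sub by blast
  \<comment> \<open>The blocks may overlap, so one block is chosen for each element;
    \<open>j\<close> is the largest index chosen.\<close>
  then obtain b where b: "\<And>a. a \<in> A \<Longrightarrow> a \<in> E (b a)" by metis
  define j where "j = Max (b ` A)"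
  have "A \<noteq> {}" using card A(2) by auto
  then have "j \<in> b ` A" unfolding j_def using fin by (intro Max_in) auto
  then obtain a where a: "a \<in> A" "a \<in> E j" using b by blast
  have le: "b a \<le> j" if "a \<in> A" for a
    unfolding j_def using that fin by (intro Max_ge) auto
  define D where "D = A - E j"
  define E' where "E' = A \<inter> E j"
  have "A = D \<union> E'" unfolding D_def E'_def by blast
  moreover have "D \<subseteq> (\<Union>i<j. E i)"
  proof
    fix x assume "x \<in> D"
    then have "x \<in> A" "x \<notin> E j" unfolding D_def by auto
    then have "b x < j" using b le by (metis le_neq_implies_less)
    then show "x \<in> (\<Union>i<j. E i)" using b[OF \<open>x \<in> A\<close>] by blast
  qed
  moreover have "card D < n"
    unfolding D_def card[symmetric] using a fin by (intro psubset_card_mono) auto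
  moreover have fD: "finite D" unfolding D_def using fin by simp
  moreover have "E' \<in> [E j]\<^bsup>(n - card D)\<^esup>"
  proof -
    have "card A = card D + card E'"
      unfolding \<open>A = D \<union> E'\<close> by (rule card_Un_disjoint) (use fin in \<open>auto simp: D_def E'_def\<close>)
    then show ?thesis unfolding nsets_def using card fin by (auto simp: E'_def)
  qed
  ultimately show ?thesis by (rule that)
qed

text \<open>A set inside one block has a color in \<open>J (n, k, f)\<close>. Otherwise its part
  \<open>D\<close> in earlier blocks has some size \<open>t\<close> between 1 and
  \<open>n - 1\<close>, and its color lies in the set coded by the limit color of \<open>D\<close>.
  The induction hypothesis bounds the number of these codes, each of which contributes at most
  \<open>l (n - t)\<close> colors.\<close>

lemma card_colors_blocks:
  fixes E :: "nat \<Rightarrow> nat set"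
  assumes J: "J \<in> Pi UNIV (color_sets l)"
  shows "n \<ge> 1 \<Longrightarrow> (\<And>A. f A < k) \<Longrightarrow>
    (\<And>j. sat J (block_constraints J n k f (\<Union>i<j. E i)) (E j)) \<Longrightarrow>
    card (f ` [\<Union>i. E i]\<^bsup>n\<^esup>) \<le> block_bound l n"
proof (induction n arbitrary: k f rule: less_induct)
  case (less n)
  let ?G = "\<Union>i. E i" and ?F = "\<lambda>j. \<Union>i<j. E i" and ?lim = "limit_coloring J n k f"
  have Jc: "J (s, k, c) \<subseteq> {..<k}" "card (J (s, k, c)) \<le> l s" "finite (J (s, k, c))" for s k c
  proof -
    have "J (s, k, c) \<in> color_sets l (s, k, c)" using J by blast
    then show "J (s, k, c) \<subseteq> {..<k}" "card (J (s, k, c)) \<le> l s" "finite (J (s, k, c))"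
      unfolding color_sets_def by (auto intro: finite_subset)
  qed
  have IH: "card (?lim t ` [?G]\<^bsup>t\<^esup>) \<le> block_bound l t" if t: "t \<in> {1..<n}" for t
  proof (rule less.IH)
    show "sat J (block_constraints J t (2 ^ k) (?lim t) (?F j)) (E j)" for j
    proof -
      have "block_constraints J t (2 ^ k) (?lim t) (?F j) \<subseteq> block_constraints J n k f (?F j)"
        using t by (subst (2) block_constraints.simps) blast
      then show ?thesis using less.prems(3)[of j] unfolding sat_def by blast
    qed
  qed (use t limit_coloring_less[OF J] in auto)
  have fin_lim: "finite (?lim t ` [?G]\<^bsup>t\<^esup>)" for t
    by (rule finite_subset[of _ "{..<2 ^ k}"]) (use limit_coloring_less[OF J] in auto)
  define V where "V t = (\<Union>v\<in>?lim t ` [?G]\<^bsup>t\<^esup>. set_decode v)" for t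
  have cover: "f ` [?G]\<^bsup>n\<^esup> \<subseteq> J (n, k, f) \<union> (\<Union>t\<in>{1..<n}. V t)"
  proof
    fix v assume "v \<in> f ` [?G]\<^bsup>n\<^esup>"
    then obtain A where A: "A \<in> [?G]\<^bsup>n\<^esup>" "v = f A" by blast
    obtain j D E' where D: "A = D \<union> E'" "D \<subseteq> ?F j" "card D < n" "finite D" "E' \<in> [E j]\<^bsup>(n - card D)\<^esup>"
      by (rule nsets_Union_blocks[OF A(1) less.prems(1)])
    have "(n - card D, k, \<lambda>E. f (D \<union> E)) \<in> block_constraints J n k f (?F j)"
      using D(2,3) by (subst block_constraints.simps) blast
    then have "(\<lambda>E. f (D \<union> E)) ` [E j]\<^bsup>(n - card D)\<^esup> \<subseteq> J (n - card D, k, \<lambda>E. f (D \<union> E))"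
      using less.prems(3)[of j] unfolding sat_def by fast
    then have v: "v \<in> J (n - card D, k, \<lambda>E. f (D \<union> E))" using A(2) D(1,5) by blast
    show "v \<in> J (n, k, f) \<union> (\<Union>t\<in>{1..<n}. V t)"
    proof (cases "D = {}")
      case True
      then show ?thesis using v by simp
    next
      case False
      then have t: "card D \<in> {1..<n}" using D(3,4) by (simp add: Suc_le_eq card_gt_0_iff)
      have "D \<in> [?G]\<^bsup>card D\<^esup>" using D(2,4) unfolding nsets_def by auto
      moreover have "v \<in> set_decode (?lim (card D) D)"
        unfolding limit_coloring_def using v Jc(3) by simp
      ultimately have "v \<in> V (card D)" unfolding V_def by blast
      then show ?thesis using t by blast
    qed
  qed
  have V: "finite (V t) \<and> card (V t) \<le> l (n - t) * block_bound l t" if t: "t \<in> {1..<n}" for t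
  proof -
    have "card (set_decode v) \<le> l (n - t)" if "v \<in> ?lim t ` [?G]\<^bsup>t\<^esup>" for v
      using that Jc(2,3) unfolding limit_coloring_def by auto
    then have "card (V t) \<le> (\<Sum>v\<in>?lim t ` [?G]\<^bsup>t\<^esup>. l (n - t))"
      unfolding V_def by (intro order_trans[OF card_UN_le[OF fin_lim]] sum_mono)
    also have "\<dots> = l (n - t) * card (?lim t ` [?G]\<^bsup>t\<^esup>)" by simp
    also have "\<dots> \<le> l (n - t) * block_bound l t" using IH[OF t] by (rule mult_le_mono2)
    finally have "card (V t) \<le> l (n - t) * block_bound l t" .
    moreover have "finite (V t)" unfolding V_def by (intro finite_UN_I fin_lim finite_set_decode)
    ultimately show ?thesis by blast
  qed
  have "card (f ` [?G]\<^bsup>n\<^esup>) \<le> card (J (n, k, f) \<union> (\<Union>t\<in>{1..<n}. V t))"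
    by (rule card_mono[OF _ cover]) (use V Jc(3) in auto)
  also have "\<dots> \<le> card (J (n, k, f)) + card (\<Union>t\<in>{1..<n}. V t)"
    by (rule card_Un_le)
  also have "\<dots> \<le> l n + (\<Sum>t\<in>{1..<n}. card (V t))"
    by (intro add_mono Jc card_UN_le) auto
  also have "\<dots> \<le> l n + (\<Sum>t\<in>{1..<n}. l (n - t) * block_bound l t)"
    using V by (intro add_mono sum_mono) auto
  also have "\<dots> = block_bound l n" by (rule block_bound.simps[symmetric])
  finally show ?case .
qed

section \<open>The bound as a sum over decreasing sequences\<close>

lemma Dec_eq: "Dec n = (\<Union>t\<in>{1..<n}. insert [t] ((#) t ` Dec t))"
proof (intro equalityI subsetI)
  fix \<sigma> assume \<sigma>: "\<sigma> \<in> Dec n"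
  then obtain t \<tau> where t: "\<sigma> = t # \<tau>" unfolding Dec_def by (cases \<sigma>) auto
  have "\<tau> \<in> Dec t" if "\<tau> \<noteq> []"
    using \<sigma> that unfolding Dec_def t by (auto simp: subset_iff)
  then show "\<sigma> \<in> (\<Union>t\<in>{1..<n}. insert [t] ((#) t ` Dec t))"
    using \<sigma> unfolding t Dec_def[of n] by (cases "\<tau> = []") auto
qed (auto simp: Dec_def subset_iff)

text \<open>The first factor of the product for \<open>t # \<sigma>\<close> is the leading factor of
  \<open>ell_vec l t \<sigma>\<close>.\<close>

lemma ell_vec_Cons:
  assumes "\<sigma> \<noteq> []"
  shows "ell_vec l n (t # \<sigma>) = l (n - t) * ell_vec l t \<sigma>"
proof -
  have "(\<Prod>i\<in>{1..<Suc (length \<sigma>)}. l ((t # \<sigma>) ! (i - 1) - (t # \<sigma>) ! i))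
      = (\<Prod>i\<in>{0..<length \<sigma>}. l ((t # \<sigma>) ! i - \<sigma> ! i))"
    using prod.shift_bounds_Suc_ivl[of "\<lambda>i. l ((t # \<sigma>) ! (i - 1) - (t # \<sigma>) ! i)" 0 "length \<sigma>"] by simp
  also have "\<dots> = l (t - \<sigma> ! 0) * (\<Prod>i\<in>{1..<length \<sigma>}. l ((t # \<sigma>) ! i - \<sigma> ! i))"
    using assms by (subst prod.atLeast_Suc_lessThan) auto
  also have "(\<Prod>i\<in>{1..<length \<sigma>}. l ((t # \<sigma>) ! i - \<sigma> ! i))
      = (\<Prod>i\<in>{1..<length \<sigma>}. l (\<sigma> ! (i - 1) - \<sigma> ! i))"
    by (rule prod.cong) (auto simp: nth_Cons')
  finally show ?thesis unfolding ell_vec_def by simp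
qed

text \<open>Sequences are grouped by their first entry \<open>t\<close>. The sequence
  \<open>[t]\<close> accounts for the summand \<open>l t\<close> of \<open>block_bound l t\<close>,
  the longer ones for its sum over \<open>Dec t\<close>.\<close>

lemma block_bound_eq: "block_bound l n = l n + (\<Sum>\<sigma>\<in>Dec n. ell_vec l n \<sigma> * l (last \<sigma>))"
proof (induction n rule: less_induct)
  case (less n)
  let ?w = "\<lambda>n \<sigma>. ell_vec l n \<sigma> * l (last \<sigma>)"
  have "(\<Sum>\<sigma>\<in>Dec n. ?w n \<sigma>) = (\<Sum>t\<in>{1..<n}. \<Sum>\<sigma>\<in>insert [t] ((#) t ` Dec t). ?w n \<sigma>)"
    unfolding Dec_eq[of n] by (rule sum.UNION_disjoint) (auto simp: finite_Dec)
  also have "\<dots> = (\<Sum>t\<in>{1..<n}. l (n - t) * block_bound l t)"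
  proof (rule sum.cong[OF refl])
    fix t assume t: "t \<in> {1..<n}"
    have ne: "[] \<notin> Dec t" by (simp add: Dec_def)
    have "(\<Sum>\<sigma>\<in>insert [t] ((#) t ` Dec t). ?w n \<sigma>) = ?w n [t] + (\<Sum>\<sigma>\<in>(#) t ` Dec t. ?w n \<sigma>)"
      using ne by (intro sum.insert) (auto simp: finite_Dec)
    also have "(\<Sum>\<sigma>\<in>(#) t ` Dec t. ?w n \<sigma>) = (\<Sum>\<sigma>\<in>Dec t. ?w n (t # \<sigma>))"
      by (simp add: sum.reindex)
    also have "\<dots> = (\<Sum>\<sigma>\<in>Dec t. l (n - t) * ?w t \<sigma>)"
      by (rule sum.cong) (use ne in \<open>auto simp: ell_vec_Cons\<close>)
    also have "?w n [t] = l (n - t) * l t" by (simp add: ell_vec_def)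
    finally show "(\<Sum>\<sigma>\<in>insert [t] ((#) t ` Dec t). ?w n \<sigma>) = l (n - t) * block_bound l t"
      using less.IH[of t] t by (simp add: sum_distrib_left algebra_simps)
  qed
  finally show ?case by (simp add: block_bound.simps[of l n])
qed

section \<open>Construction of the solution\<close>

text \<open>The bounds on \<open>a\<close> make the join decidable and show that its elements below
  a number depend only on smaller parts of both components.\<close>

lemma mem_join_iff: "q \<in> A \<oplus>\<^sub>T C \<longleftrightarrow> (\<exists>a\<le>q. q = 2 * a \<and> a \<in> A) \<or> (\<exists>a\<le>q. q = 2 * a + 1 \<and> a \<in> C)"
  unfolding turing_join_def by auto

lemma eval_join_cong:
  assumes "eval (A \<oplus>\<^sub>T C) p xs y"
  shows "\<exists>b. \<forall>A'. (\<forall>x<b. x \<in> A' \<longleftrightarrow> x \<in> A) \<longrightarrow> eval (A' \<oplus>\<^sub>T C) p xs y"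
proof -
  obtain b where b: "\<And>S. (\<forall>x<b. x \<in> S \<longleftrightarrow> x \<in> A \<oplus>\<^sub>T C) \<Longrightarrow> eval S p xs y"
    using eval_use[OF assms] by blast
  have "eval (A' \<oplus>\<^sub>T C) p xs y" if "\<forall>x<b. x \<in> A' \<longleftrightarrow> x \<in> A" for A'
  proof (rule b, intro allI impI)
    fix x assume "x < b"
    then have "\<forall>a\<le>x. a \<in> A' \<longleftrightarrow> a \<in> A" using that by simp
    then show "x \<in> A' \<oplus>\<^sub>T C \<longleftrightarrow> x \<in> A \<oplus>\<^sub>T C" unfolding mem_join_iff by blast
  qed
  then show ?thesis by blast
qed

context generic_ideal
begin

text \<open>More constraints admit fewer blocks, which only helps the first clause of
  \<open>stuck\<close>; the second clause does not mention the constraints.\<close>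

lemma small_mono:
  assumes "K \<subseteq> K'" "small J K"
  shows "small J K'"
proof -
  obtain X R where X: "X \<in> U" "req R" "stuck X R J K" using assms(2) unfolding small_def by blast
  have sat: "sat J K E" if "sat J K' E" for E using that assms(1) unfolding sat_def by blast
  have "stuck X R J K'"
    unfolding stuck_def
  proof (rule conjI[OF _ conjunct2[OF X(3)[unfolded stuck_def]]], intro allI impI)
    fix x E assume "E \<noteq> {} \<and> finite E \<and> E \<subseteq> X \<and> sat J K' E"
    then have "E \<noteq> {} \<and> finite E \<and> E \<subseteq> X \<and> sat J K E" using sat by simp
    then show "\<not> R x (of_bool (x \<notin> B)) E"
      by (rule conjunct1[OF X(3)[unfolded stuck_def], THEN spec, THEN spec, THEN mp])
  qed
  then show ?thesis unfolding small_def using X by blast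
qed

lemma small_local:
  assumes "\<And>\<kappa>. \<kappa> \<in> K \<Longrightarrow> J \<kappa> = J' \<kappa>" "small J K"
  shows "small J' K"
proof -
  have "sat J K = sat J' K"
    unfolding sat_def using assms(1) by (intro ext ball_cong) auto
  then show ?thesis using assms(2) unfolding small_def stuck_def by simp
qed

text \<open>Intersecting with \<open>colorings n\<close> turns the finite statement of
  \<open>ex_not_small\<close> into one about all finite sets of constraints, as compactness
  demands.\<close>

lemma coherent_assignment:
  obtains J where "J \<in> Pi UNIV (color_sets l)"
    "\<And>K. finite K \<Longrightarrow> K \<subseteq> colorings n \<Longrightarrow> \<not> small J K"
proof -
  have fin: "finite (color_sets l \<kappa>)" for \<kappa>
    unfolding color_sets_def by (cases \<kappa>) (auto intro: finite_subset[of _ "Pow {..<_}"])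
  have ex: "\<exists>J\<in>Pi UNIV (color_sets l). \<not> small J (K \<inter> colorings n)" if K: "finite K" for K
  proof -
    obtain J where J: "J \<in> Pi\<^sub>E (K \<inter> colorings n) (color_sets l)" "\<not> small J (K \<inter> colorings n)"
      using ex_not_small[of "K \<inter> colorings n"] K by blast
    \<comment> \<open>The empty set of colors is a legal default outside the finite domain.\<close>
    define J' where "J' \<kappa> = (if \<kappa> \<in> K \<inter> colorings n then J \<kappa> else {})" for \<kappa>
    have "\<not> small J' (K \<inter> colorings n)"
      using small_local[of "K \<inter> colorings n" J' J] J(2) unfolding J'_def by auto
    moreover have "J' \<kappa> \<in> color_sets l \<kappa>" for \<kappa>
    proof (cases "\<kappa> \<in> K \<inter> colorings n")
      case True
      then show ?thesis unfolding J'_def using J(1) by auto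
    qed (auto simp: J'_def color_sets_def)
    ultimately show ?thesis by blast
  qed
  have local: "small J' (K \<inter> colorings n)"
    if "\<And>i. i \<in> K \<Longrightarrow> J i = J' i" "small J (K \<inter> colorings n)" for K J J'
    using small_local[of "K \<inter> colorings n" J J'] that by blast
  have mono: "small J (K' \<inter> colorings n)"
    if "K \<subseteq> K'" "small J (K \<inter> colorings n)" for K K' J
    using small_mono[of "K \<inter> colorings n" "K' \<inter> colorings n" J] that by blast
  show ?thesis
  proof (rule compactness_choice[of "color_sets l" "\<lambda>J K. small J (K \<inter> colorings n)", OF fin ex local mono])
    fix J assume J: "J \<in> Pi UNIV (color_sets l)" "\<And>K. finite K \<Longrightarrow> \<not> small J (K \<inter> colorings n)"
    show thesis
    proof (rule that[OF J(1)])
      fix K assume "finite K" "K \<subseteq> colorings n"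
      then show "\<not> small J K" using J(2)[of K] by (simp add: Int_absorb2)
    qed
  qed
qed

section \<open>One step of the construction\<close>

lemma req_True: "req (\<lambda>x v E. True)"
  unfolding req_def by (rule sig_dec[OF dec_const])

lemma req_eval:
  assumes C: "C \<in> \<M>" and F: "finite F"
  shows "req (\<lambda>x v E. eval ((F \<union> E) \<oplus>\<^sub>T C) p [x] v)"
proof -
  have "dec (\<lambda>z. pi2 z \<in> (F \<union> set_decode (pi1 z)) \<oplus>\<^sub>T C)"
    unfolding mem_join_iff Un_iff
    by (intro mrec_basic dec_set_decode dec_mem[OF C] dec_mem_finite[OF F])
  then have "sig (\<lambda>z. eval ((F \<union> set_decode (pi2 (pi2 z))) \<oplus>\<^sub>T C) p (list_decode (consc (pi1 z) 0)) (pi1 (pi2 z)))"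
    by (rule sig_eval) (intro mrec_basic)+
  then show ?thesis unfolding req_def list_decode_consc by simp
qed

text \<open>The Mathias condition \<open>(F, X)\<close> forces that \<open>p\<close> with side
  oracle \<open>C\<close> does not compute \<open>B\<close> from the solution.\<close>

definition avoids :: "nat set \<Rightarrow> nat set \<Rightarrow> prog \<Rightarrow> nat set \<Rightarrow> bool" where
  "avoids F X p C \<longleftrightarrow> (\<forall>G. F \<subseteq> G \<and> G \<subseteq> F \<union> X \<longrightarrow>
     \<not> (\<forall>x. eval (G \<oplus>\<^sub>T C) p [x] (if x \<in> B then 1 else 0)))"

lemma not_smallE:
  assumes "\<not> small J K" "X \<in> U" "req R"
  obtains (force) x E where "E \<noteq> {}" "finite E" "E \<subseteq> X" "sat J K E" "R x (of_bool (x \<notin> B)) E"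
  | (avoid) x Z where "Z \<in> U" "\<And>E. E \<noteq> {} \<Longrightarrow> finite E \<Longrightarrow> E \<subseteq> Z \<Longrightarrow> \<not> R x (of_bool (x \<in> B)) E"
proof -
  have "\<not> stuck X R J K" using assms unfolding small_def by blast
  then consider
      "\<exists>x E. (E \<noteq> {} \<and> finite E \<and> E \<subseteq> X \<and> sat J K E) \<and> R x (of_bool (x \<notin> B)) E"
    | "\<exists>x. \<exists>Z\<in>U. \<forall>E. \<not> (E \<noteq> {} \<and> finite E \<and> E \<subseteq> Z \<and> R x (of_bool (x \<in> B)) E)"
    unfolding stuck_def not_all not_ex de_Morgan_conj not_imp bex_simps ball_simps by blast
  then show thesis
  proof cases
    case 1
    then show thesis by (elim exE conjE) (rule force)
  next
    case 2
    then obtain x Z where "Z \<in> U" "\<forall>E. \<not> (E \<noteq> {} \<and> finite E \<and> E \<subseteq> Z \<and> R x (of_bool (x \<in> B)) E)"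
      by (elim exE bexE)
    then show thesis by (intro avoid[of Z x]) blast+
  qed
qed

text \<open>The trivial requirement cannot be avoided on an infinite reservoir, so it must be met by
  an admissible block.\<close>

lemma ex_block:
  assumes "\<not> small J K" "X \<in> U"
  obtains E where "E \<noteq> {}" "finite E" "E \<subseteq> X" "sat J K E"
proof (rule not_smallE[OF assms req_True])
  fix Z assume Z: "Z \<in> U" "\<And>E. E \<noteq> {} \<Longrightarrow> finite E \<Longrightarrow> E \<subseteq> Z \<Longrightarrow> \<not> True"
  obtain z where "z \<in> Z" using U_infinite[OF Z(1)] by (metis finite.emptyI all_not_in_conv)
  then show ?thesis using Z(2)[of "{z}"] by auto
qed (rule that)

text \<open>If a block forces a wrong value, the new reservoir starts beyond the use of that
  computation and preserves it. If a smaller reservoir avoids the right value, any admissible block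
  from that reservoir will do.\<close>

lemma extend_block:
  assumes K: "\<not> small J K" and F: "finite F" and X: "X \<in> U" and C: "C \<in> \<M>"
  obtains E Y where "E \<noteq> {}" "finite E" "E \<subseteq> X" "sat J K E"
    "Y \<in> U" "Y \<subseteq> X" "\<forall>y\<in>F \<union> E. \<forall>x\<in>Y. y < x" "avoids (F \<union> E) Y p C"
proof -
  have tail: "\<exists>Y\<in>U. Y \<subseteq> Z \<and> (\<forall>x\<in>Y. b \<le> x) \<and> (\<forall>y\<in>S. \<forall>x\<in>Y. y < x)"
    if Z: "Z \<in> U" and S: "finite S" for Z b S
  proof -
    obtain b' where b': "S \<subseteq> {..<b'}" using S finite_nat_iff_bounded by blast
    obtain Y' where Y': "Y' \<in> U" "\<forall>x\<in>Y'. max b b' \<le> x" using U_tail by blast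
    obtain Y where "Y \<in> U" "Y \<subseteq> Z" "Y \<subseteq> Y'" using U_directed[OF Z Y'(1)] by blast
    then show ?thesis using Y'(2) b' by (intro bexI[of _ Y]) fastforce+
  qed
  show ?thesis
  proof (rule not_smallE[OF K X req_eval[OF C F]])
    fix x E assume E: "E \<noteq> {}" "finite E" "E \<subseteq> X" "sat J K E"
      and ev: "eval ((F \<union> E) \<oplus>\<^sub>T C) p [x] (of_bool (x \<notin> B))"
    obtain b where b: "\<And>A'. (\<forall>a<b. a \<in> A' \<longleftrightarrow> a \<in> F \<union> E) \<Longrightarrow> eval (A' \<oplus>\<^sub>T C) p [x] (of_bool (x \<notin> B))"
      using eval_join_cong[OF ev] by blast
    obtain Y where Y: "Y \<in> U" "Y \<subseteq> X" "\<forall>a\<in>Y. b \<le> a" "\<forall>y\<in>F \<union> E. \<forall>a\<in>Y. y < a"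
      using tail[OF X, of "F \<union> E" b] F E(2) by blast
    have "avoids (F \<union> E) Y p C"
      unfolding avoids_def
    proof (intro allI impI notI)
      fix G assume G: "F \<union> E \<subseteq> G \<and> G \<subseteq> F \<union> E \<union> Y"
        and ev': "\<forall>x. eval (G \<oplus>\<^sub>T C) p [x] (if x \<in> B then 1 else 0)"
      have "\<forall>a<b. a \<in> G \<longleftrightarrow> a \<in> F \<union> E" using G Y(3) by (meson Un_iff not_le subsetD)
      then have "eval (G \<oplus>\<^sub>T C) p [x] (of_bool (x \<notin> B))" by (rule b)
      then have "of_bool (x \<notin> B) = (if x \<in> B then 1 else 0 :: nat)"
        using ev' eval_deterministic by blast
      then show False by (auto split: if_splits)
    qed
    then show thesis using that[OF E Y(1,2,4)] by blast
  next
    fix x Z assume Z: "Z \<in> U"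
      and no: "\<And>E. E \<noteq> {} \<Longrightarrow> finite E \<Longrightarrow> E \<subseteq> Z \<Longrightarrow> \<not> eval ((F \<union> E) \<oplus>\<^sub>T C) p [x] (of_bool (x \<in> B))"
    obtain Z' where Z': "Z' \<in> U" "Z' \<subseteq> X" "Z' \<subseteq> Z" using U_directed[OF X Z] by blast
    obtain E where E: "E \<noteq> {}" "finite E" "E \<subseteq> Z'" "sat J K E" using ex_block[OF K Z'(1)] by blast
    obtain Y where Y: "Y \<in> U" "Y \<subseteq> Z'" "\<forall>y\<in>F \<union> E. \<forall>a\<in>Y. y < a"
      using tail[OF Z'(1), of "F \<union> E" 0] F E(2) by blast
    have "avoids (F \<union> E) Y p C"
      unfolding avoids_def
    proof (intro allI impI notI)
      fix G assume G: "F \<union> E \<subseteq> G \<and> G \<subseteq> F \<union> E \<union> Y"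
        and ev': "\<forall>x. eval (G \<oplus>\<^sub>T C) p [x] (if x \<in> B then 1 else 0)"
      have "eval (G \<oplus>\<^sub>T C) p [x] (of_bool (x \<in> B))" using ev' by (simp add: of_bool_def)
      from eval_join_cong[OF this] obtain b where
        b: "\<And>A'. (\<forall>a<b. a \<in> A' \<longleftrightarrow> a \<in> G) \<Longrightarrow> eval (A' \<oplus>\<^sub>T C) p [x] (of_bool (x \<in> B))" by blast
      \<comment> \<open>The part of \<open>G\<close> beyond \<open>F\<close> that the computation
        uses, enlarged by \<open>E\<close> to be nonempty. It is a finite subset of \<open>Z\<close>
        that would produce the avoided value.\<close>
      define E2 where "E2 = E \<union> ((G - F) \<inter> {..<b})"
      have "\<forall>a<b. a \<in> F \<union> E2 \<longleftrightarrow> a \<in> G" using G unfolding E2_def by blast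
      then have "eval ((F \<union> E2) \<oplus>\<^sub>T C) p [x] (of_bool (x \<in> B))" by (rule b)
      moreover have "E2 \<noteq> {}" "finite E2" unfolding E2_def using E by auto
      moreover have "E2 \<subseteq> Z" unfolding E2_def using E(3) Z'(3) Y(2) G by blast
      ultimately show False using no by blast
    qed
    moreover have "E \<subseteq> X" "Y \<subseteq> X" using E(3) Y(2) Z'(2) by auto
    ultimately show thesis using that E Y by blast
  qed
qed

text \<open>Stage \<open>i\<close> adds one block that obeys the constraints of all earlier blocks,
  and shrinks the reservoir so as to defeat the \<open>i\<close>-th pair of a program and a member
  of the ideal.\<close>

lemma cone_avoiding_solution:
  fixes f :: "nat set \<Rightarrow> nat"
  assumes cM: "countable \<M>" and n: "n \<ge> 1" and f: "\<And>A. f A < k"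
  shows "\<exists>G. infinite G \<and> card (f ` [G]\<^bsup>n\<^esup>) \<le> block_bound l n \<and> (\<forall>C\<in>\<M>. \<not> B \<le>\<^sub>T (G \<oplus>\<^sub>T C))"
proof -
  obtain J where J: "J \<in> Pi UNIV (color_sets l)"
    and ns: "\<And>K. finite K \<Longrightarrow> K \<subseteq> colorings n \<Longrightarrow> \<not> small J K"
    by (rule coherent_assignment) (rule that)
  let ?K = "block_constraints J n k f"
  have K: "\<not> small J (?K F)" if "finite F" for F
  proof -
    have "finite (?K F) \<and> ?K F \<subseteq> colorings n"
      by (rule block_constraints_colorings[OF J that order_refl f])
    then show ?thesis by (elim conjE) (rule ns)
  qed
  define tasks where "tasks = from_nat_into ((UNIV :: prog set) \<times> \<M>)"
  have cT: "countable ((UNIV :: prog set) \<times> \<M>)" using cM by simp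
  have neT: "(UNIV :: prog set) \<times> \<M> \<noteq> {}" using ideal_nonempty by simp
  have tasks: "snd (tasks i) \<in> \<M>" for i
    using from_nat_into[OF neT, of i] unfolding tasks_def by auto
  define good where "good S \<longleftrightarrow> finite (fst S) \<and> snd S \<in> U \<and> (\<forall>y\<in>fst S. \<forall>x\<in>snd S. y < x)"
    for S :: "nat set \<times> nat set"
  define step where "step i S S' \<longleftrightarrow> (\<exists>E. E \<noteq> {} \<and> E \<subseteq> snd S \<and> sat J (?K (fst S)) E
      \<and> fst S' = fst S \<union> E \<and> snd S' \<subseteq> snd S \<and> avoids (fst S') (snd S') (fst (tasks i)) (snd (tasks i)))"
    for i and S S' :: "nat set \<times> nat set"
  have next_stage: "\<exists>S'. good S' \<and> step i S S'" if S: "good S" for S i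
  proof -
    have "finite (fst S)" "snd S \<in> U" using S unfolding good_def by auto
    from extend_block[OF K[OF this(1)] this tasks[of i], of "fst (tasks i)"] obtain E Y where
      "E \<noteq> {}" "finite E" "E \<subseteq> snd S" "sat J (?K (fst S)) E" "Y \<in> U" "Y \<subseteq> snd S"
      "\<forall>y\<in>fst S \<union> E. \<forall>x\<in>Y. y < x" "avoids (fst S \<union> E) Y (fst (tasks i)) (snd (tasks i))" .
    then have "good (fst S \<union> E, Y)" "step i S (fst S \<union> E, Y)"
      unfolding good_def step_def using \<open>finite (fst S)\<close> by auto
    then show ?thesis by blast
  qed
  obtain X0 where "X0 \<in> U" using U_nonempty by blast
  have "\<exists>S. S 0 = ({}, X0) \<and> (\<forall>i. good (S i)) \<and> (\<forall>i. step i (S i) (S (Suc i)))"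
  proof -
    define S where "S = rec_nat ({}, X0) (\<lambda>i s. SOME s'. good s' \<and> step i s s')"
    have S: "S 0 = ({}, X0)" "S (Suc i) = (SOME s'. good s' \<and> step i (S i) s')" for i
      unfolding S_def by simp_all
    have g: "good (S i)" for i
    proof (induction i)
      case 0
      then show ?case using \<open>X0 \<in> U\<close> by (simp add: S good_def)
    next
      case (Suc i)
      then show ?case using someI_ex[OF next_stage[OF Suc, of i]] by (simp add: S(2))
    qed
    have "step i (S i) (S (Suc i))" for i
      using someI_ex[OF next_stage[OF g, of i i]] by (simp add: S(2))
    then show ?thesis using S(1) g by blast
  qed
  then obtain S where S: "S 0 = ({}, X0)" "\<And>i. good (S i)" "\<And>i. step i (S i) (S (Suc i))" by blast
  have "\<forall>i. \<exists>E. E \<noteq> {} \<and> E \<subseteq> snd (S i) \<and> sat J (?K (fst (S i))) E \<and> fst (S (Suc i)) = fst (S i) \<union> E"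
  proof
    fix i
    from S(3)[of i] show "\<exists>E. E \<noteq> {} \<and> E \<subseteq> snd (S i) \<and> sat J (?K (fst (S i))) E \<and> fst (S (Suc i)) = fst (S i) \<union> E"
      unfolding step_def by (elim exE conjE) (intro exI conjI)
  qed
  from choice[OF this] obtain E where E0: "\<forall>i. E i \<noteq> {} \<and> E i \<subseteq> snd (S i) \<and> sat J (?K (fst (S i))) (E i)
      \<and> fst (S (Suc i)) = fst (S i) \<union> E i" ..
  then have E: "\<And>i. E i \<noteq> {}" "\<And>i. E i \<subseteq> snd (S i)" "\<And>i. sat J (?K (fst (S i))) (E i)"
    "\<And>i. fst (S (Suc i)) = fst (S i) \<union> E i" by simp_all
  have F: "fst (S j) = (\<Union>i<j. E i)" for j
    by (induction j) (auto simp: S(1) E(4) lessThan_Suc)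
  have anti: "snd (S j) \<subseteq> snd (S i)" if "i \<le> j" for i j
    by (rule lift_Suc_antimono_le[OF _ that, of "\<lambda>i. snd (S i)"]) (use S(3) in \<open>auto simp: step_def\<close>)
  define G where "G = (\<Union>i. E i)"
  have "infinite G"
  proof
    assume "finite G"
    then obtain b where b: "G \<subseteq> {..<b}" using finite_nat_iff_bounded by blast
    \<comment> \<open>Each block lies strictly above all earlier ones, so block \<open>i\<close>
      reaches at least \<open>i\<close>.\<close>
    have "\<exists>x\<in>E i. i \<le> x" for i
    proof (induction i)
      case 0
      then show ?case using E(1) by auto
    next
      case (Suc i)
      then obtain x where x: "x \<in> E i" "i \<le> x" by blast
      obtain y where y: "y \<in> E (Suc i)" using E(1) by blast
      have "x \<in> fst (S (Suc i))" using x E(4) by blast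
      moreover have "y \<in> snd (S (Suc i))" using y E(2) by blast
      ultimately have "x < y" using S(2)[of "Suc i"] unfolding good_def by blast
      then show ?case using x(2) y by (intro bexI[of _ y]) auto
    qed
    then obtain x where "x \<in> E b" "b \<le> x" by blast
    then show False using b unfolding G_def by fastforce
  qed
  moreover have "card (f ` [G]\<^bsup>n\<^esup>) \<le> block_bound l n"
    unfolding G_def by (rule card_colors_blocks[OF J n f]) (use E(3) F in simp)
  moreover have "\<not> B \<le>\<^sub>T (G \<oplus>\<^sub>T C)" if C: "C \<in> \<M>" for C
  proof
    assume "B \<le>\<^sub>T (G \<oplus>\<^sub>T C)"
    then obtain p where p: "\<forall>x. eval (G \<oplus>\<^sub>T C) p [x] (if x \<in> B then 1 else 0)"
      unfolding turing_reducible_def by blast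
    obtain i where i: "tasks i = (p, C)"
      unfolding tasks_def using from_nat_into_surj[OF cT, of "(p, C)"] C by auto
    have "avoids (fst (S (Suc i))) (snd (S (Suc i))) p C"
      using S(3)[of i] i unfolding step_def by auto
    moreover have "fst (S (Suc i)) \<subseteq> G" unfolding F G_def by blast
    \<comment> \<open>Later blocks come from reservoirs contained in that of stage
      \<open>Suc i\<close>, so \<open>G\<close> is among the sets covered by
      \<open>avoids\<close>.\<close>
    moreover have "G \<subseteq> fst (S (Suc i)) \<union> snd (S (Suc i))"
    proof
      fix x assume "x \<in> G"
      then obtain j where j: "x \<in> E j" unfolding G_def by blast
      show "x \<in> fst (S (Suc i)) \<union> snd (S (Suc i))"
      proof (cases "j < Suc i")
        case True
        then show ?thesis using j unfolding F by blast
      next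
        case False
        then show ?thesis using j E(2)[of j] anti[of "Suc i" j] by auto
      qed
    qed
    ultimately show False using p unfolding avoids_def by blast
  qed
  ultimately show ?thesis by blast
qed

end

lemma scott_Scott_set: "Scott_set \<M> \<Longrightarrow> scott \<M>"
  unfolding Scott_set_def by unfold_locales blast+

theorem theorem4p3:
  fixes n :: nat and \<M> :: "nat set set" and l :: "nat \<Rightarrow> nat"
  assumes "n \<ge> 1"
    and "countable \<M>"
    and "Scott_set \<M>"
    and "\<And>s. s \<in> {1..n} \<Longrightarrow> l s \<ge> 1 \<and> models_RT \<M> s (l s)"
  shows "\<forall>B k f. B \<notin> \<M> \<longrightarrow> f \<in> [UNIV]\<^bsup>n\<^esup> \<rightarrow> {..<k :: nat} \<longrightarrow>
    (\<exists>G :: nat set. infinite G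
      \<and> card (f ` [G]\<^bsup>n\<^esup>) \<le> l n + (\<Sum>\<sigma>\<in>Dec n. ell_vec l n \<sigma> * l (last \<sigma>))
      \<and> (\<forall>C\<in>\<M>. \<not> B \<le>\<^sub>T (G \<oplus>\<^sub>T C)))"
proof (intro allI impI)
  fix B k and f :: "nat set \<Rightarrow> nat"
  assume B: "B \<notin> \<M>" and f: "f \<in> [UNIV]\<^bsup>n\<^esup> \<rightarrow> {..<k}"
  interpret scott \<M> by (rule scott_Scott_set[OF assms(3)])
  show "\<exists>G :: nat set. infinite G
      \<and> card (f ` [G]\<^bsup>n\<^esup>) \<le> l n + (\<Sum>\<sigma>\<in>Dec n. ell_vec l n \<sigma> * l (last \<sigma>))
      \<and> (\<forall>C\<in>\<M>. \<not> B \<le>\<^sub>T (G \<oplus>\<^sub>T C))" (is ?thesis)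
  proof (rule generic_filter[OF assms(2), of n l])
    show "models_RT \<M> s (l s)" if "s \<in> {1..n}" for s using assms(4)[OF that] by blast
  next
    fix U assume U: "U \<subseteq> \<M>" "U \<noteq> {}" "\<And>X. X \<in> U \<Longrightarrow> infinite X"
      "\<And>X Y. X \<in> U \<Longrightarrow> Y \<in> U \<Longrightarrow> \<exists>Z\<in>U. Z \<subseteq> X \<and> Z \<subseteq> Y"
      "\<And>b. \<exists>X\<in>U. \<forall>x\<in>X. b \<le> x"
      "\<And>\<phi> k s. mrec \<phi> \<Longrightarrow> (\<And>d. \<phi> d < k) \<Longrightarrow> s \<in> {1..n} \<Longrightarrow>
        \<exists>X\<in>U. card ((\<lambda>F. \<phi> (set_encode F)) ` [X]\<^bsup>s\<^esup>) \<le> l s"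
    interpret generic_ideal \<M> U n l B
      by (rule generic_ideal.intro[OF scott_Scott_set[OF assms(3)] generic_ideal_axioms.intro[OF U B]])
    \<comment> \<open>The construction needs a coloring bounded on all sets, while \<open>f\<close>
      is bounded on \<open>n\<close>-element sets only. The default 0 is a color because
      \<open>{..<n}\<close> has a color below \<open>k\<close>.\<close>
    define f' where "f' A = (if f A < k then f A else 0)" for A
    have "{..<n} \<in> [UNIV]\<^bsup>n\<^esup>" by (simp add: nsets_def)
    then have "0 < k" using f by fastforce
    then have "f' A < k" for A unfolding f'_def by simp
    from cone_avoiding_solution[OF assms(2,1), of f' k, OF this] obtain G where
      G: "infinite G" "card (f' ` [G]\<^bsup>n\<^esup>) \<le> block_bound l n" "\<forall>C\<in>\<M>. \<not> B \<le>\<^sub>T (G \<oplus>\<^sub>T C)" by blast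
    have "f' A = f A" if "A \<in> [G]\<^bsup>n\<^esup>" for A
      using that f nsets_mono[of G UNIV n] unfolding f'_def by auto
    then have "f' ` [G]\<^bsup>n\<^esup> = f ` [G]\<^bsup>n\<^esup>" by (rule image_cong[OF refl])
    then show ?thesis
      using G unfolding block_bound_eq by metis
  qed
qed

end
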